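(* Let $d_u>0$ and $D>0$. There exists a constant $C>0$, independent of $d_v\in[0,D]$ and $k>0$, such that for any solution $(u^k,v^k)$ of $(P_1^k)$ satisfying $0\le u^k\le M$, $0\le v^k\le M$ on $\mathbb{R}\times(0,T)$, we have $$\int_0^T\int_{\mathbb{R}}kF(u^k,v^k)\,dx\,dt\le C.$$
   Context: $\mathbb{R}^+=[0,\infty)$; $T>0$, $Q_T=\mathbb{R}\times(0,T)$; $U_0,V_0>0$, $M\ge\max\{U_0,V_0\}$. $T,d_u,U_0,V_0,M,F$ and the family of initial data are fixed. $F:\mathbb{R}^+\times\mathbb{R}^+\to\mathbb{R}^+$ satisfies (i) $F\in C^{0,\alpha}(\mathbb{R}^+\times\mathbb{R}^+)$ for some $\alpha>0$; (ii) $F(u,0)=F(0,v)=0$ for all $u,v\in\mathbb{R}^+$ and $F(u,v)>0$ for $u,v>0$; (iii) $F(\cdot,v)$ and $F(u,\cdot)$ are non-decreasing for all $u,v\in\mathbb{R}^+$. Initial data: $u_0^\infty=U_0$ for $x<0$, $0$ for $x>0$; $v_0^\infty=0$ for $x<0$, $V_0$ for $x>0$. The functions $u_0^k,v_0^k\in C^2(\mathbb{R})$ satisfy $0\le u_0^k,v_0^k\le M$; $u_0^k(x)\to U_0,0$ and $v_0^k(x)\to0,V_0$ as $x\to-\infty,\infty$ respectively; $u_0^k-u_0^\infty,\ v_0^k-v_0^\infty\in L^1(\mathbb{R})$; $k\mapsto u_0^k-u_0^\infty$ and $k\mapsto v_0^k-v_0^\infty$ belong to $C(\mathbb{R}^+,L^1(\mathbb{R}))$;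 $u_0^k\to u_0^\infty$, $v_0^k\to v_0^\infty$ in $L^1(\mathbb{R})$ as $k\to\infty$; and there is a continuous $\omega:\mathbb{R}^+\to\mathbb{R}^+$ with $\omega(\mu)\to0$ as $\mu\to0$ and $\|u_0^k(\cdot+\xi)-u_0^k\|_{L^1(\mathbb{R})}+\|v_0^k(\cdot+\xi)-v_0^k\|_{L^1(\mathbb{R})}\le\omega(|\xi|)$ for all $k>0$, $\xi\in\mathbb{R}$. (In particular $\|u_0^k-u_0^\infty\|_{L^1(\mathbb{R})}$ and $\|v_0^k-v_0^\infty\|_{L^1(\mathbb{R})}$ are bounded independently of $k$.) Problem $(P_1^k)$: $u_t=d_uu_{xx}-kF(u,v)$, $v_t=d_vv_{xx}-kF(u,v)$ in $Q_T$, $u(\cdot,0)=u_0^k$, $v(\cdot,0)=v_0^k$ on $\mathbb{R}$ (terms multiplied by $d_v$ are absent when $d_v=0$). Solutions: if $d_v>0$, classical, with $u^k,v^k\in C^{2,1}(\mathbb{R}\times[\delta,T])\cap C^0(\mathbb{R}\times[0,T])\cap W^{2,1}_p((-J,J)\times(0,T))$ for all $\delta,J>0$, $p\ge1$. If $d_v=0$, weak, with $u^k\in W^{2,1}_p((-J,J)\times(0,T))$, $v^k\in W^{1,\infty}(0,T;L^\infty((-J,J)))$ for all $J>0$, $p\ge1$, and for all $\psi\in C^{2,1}(\overline{Q_T})$ with $\psi(\cdot,T)=0$ and $\operatorname{supp}\psi\subset[-J,J]\times[0,T]$ for some $J>0$: $\iint_{Q_T}u^k\psi_t+\iint_{Q_T}\{d_uu^k\psi_{xx}-kF(u^k,v^k)\psi\}=-\int_{\mathbb{R}}u_0^k\psi(\cdot,0)$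 and $\iint_{Q_T}v^k\psi_t-\iint_{Q_T}kF(u^k,v^k)\psi=-\int_{\mathbb{R}}v_0^k\psi(\cdot,0)$. *)

theory Defs
  imports "HOL-Analysis.Analysis" "HOL-Probability.Essential_Supremum"
begin

text \<open>Points of space-time are pairs \<open>(x, t)\<close>.\<close>

definition QT :: "real \<Rightarrow> (real \<times> real) set" where
  "QT T = UNIV \<times> {0<..<T}"

section \<open>Spaces of differentiable functions\<close>

definition C2_real :: "(real \<Rightarrow> real) \<Rightarrow> bool" where
  "C2_real f \<longleftrightarrow> (\<exists>f' f''. (\<forall>x. (f has_real_derivative f' x) (at x)) \<and>
     (\<forall>x. (f' has_real_derivative f'' x) (at x)) \<and> continuous_on UNIV f'')"

text \<open>Membership in \<open>C\<^sup>2\<^sup>,\<^sup>1\<close> of the closed strip \<open>\<real> \<times> [a,b]\<close>, with \<open>fx\<close>, \<open>fxx\<close>, \<open>ft\<close> the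
  derivatives; at the times \<open>a\<close> and \<open>b\<close> the time derivative is one-sided. No boundedness at
  spatial infinity is required.\<close>

definition C21_strip ::
  "real \<Rightarrow> real \<Rightarrow> (real \<times> real \<Rightarrow> real) \<Rightarrow> (real \<times> real \<Rightarrow> real) \<Rightarrow>
   (real \<times> real \<Rightarrow> real) \<Rightarrow> (real \<times> real \<Rightarrow> real) \<Rightarrow> bool" where
  "C21_strip a b f fx fxx ft \<longleftrightarrow>
     (\<forall>x. \<forall>t\<in>{a..b}.
        ((\<lambda>y. f (y, t)) has_real_derivative fx (x, t)) (at x) \<and>
        ((\<lambda>y. fx (y, t)) has_real_derivative fxx (x, t)) (at x) \<and>
        ((\<lambda>s. f (x, s)) has_real_derivative ft (x, t)) (at t within {a..b})) \<and>
     continuous_on (UNIV \<times> {a..b}) f \<and> continuous_on (UNIV \<times> {a..b}) fx \<and>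
     continuous_on (UNIV \<times> {a..b}) fxx \<and> continuous_on (UNIV \<times> {a..b}) ft"

section \<open>Sobolev spaces\<close>

definition pd_x :: "(real \<times> real \<Rightarrow> real) \<Rightarrow> real \<times> real \<Rightarrow> real" where
  "pd_x f = (\<lambda>(x, t). deriv (\<lambda>y. f (y, t)) x)"

definition pd_t :: "(real \<times> real \<Rightarrow> real) \<Rightarrow> real \<times> real \<Rightarrow> real" where
  "pd_t f = (\<lambda>(x, t). deriv (\<lambda>s. f (x, s)) t)"

definition smooth_plane :: "(real \<times> real \<Rightarrow> real) \<Rightarrow> bool" where
  "smooth_plane f \<longleftrightarrow> (\<forall>i j. let g = (pd_t ^^ j) ((pd_x ^^ i) f) in
     continuous_on UNIV g \<and>
     (\<forall>x t. (\<lambda>y. g (y, t)) field_differentiable at x \<and> (\<lambda>s. g (x, s)) field_differentiable at t))"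

definition test_plane :: "(real \<times> real) set \<Rightarrow> (real \<times> real \<Rightarrow> real) \<Rightarrow> bool" where
  "test_plane \<Omega> \<phi> \<longleftrightarrow> smooth_plane \<phi> \<and> compact (closure {z. \<phi> z \<noteq> 0}) \<and>
     closure {z. \<phi> z \<noteq> 0} \<subseteq> \<Omega>"

definition smooth_line :: "(real \<Rightarrow> real) \<Rightarrow> bool" where
  "smooth_line f \<longleftrightarrow> (\<forall>n x. (deriv ^^ n) f field_differentiable at x)"

definition test_line :: "real set \<Rightarrow> (real \<Rightarrow> real) \<Rightarrow> bool" where
  "test_line I \<phi> \<longleftrightarrow> smooth_line \<phi> \<and> compact (closure {t. \<phi> t \<noteq> 0}) \<and>
     closure {t. \<phi> t \<noteq> 0} \<subseteq> I"

definition in_Lp :: "real \<Rightarrow> (real \<times> real) set \<Rightarrow> (real \<times> real \<Rightarrow> real) \<Rightarrow> bool" where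
  "in_Lp p \<Omega> f \<longleftrightarrow> f \<in> borel_measurable (lebesgue_on \<Omega>) \<and>
     integrable (lebesgue_on \<Omega>) (\<lambda>z. \<bar>f z\<bar> powr p)"

text \<open>\<open>g\<close> is the weak derivative of \<open>f\<close> in \<open>\<Omega>\<close>, of order \<open>i\<close> in \<open>x\<close> and order \<open>j\<close> in \<open>t\<close>.\<close>

definition weak_pd ::
  "nat \<Rightarrow> nat \<Rightarrow> (real \<times> real) set \<Rightarrow> (real \<times> real \<Rightarrow> real) \<Rightarrow> (real \<times> real \<Rightarrow> real) \<Rightarrow> bool" where
  "weak_pd i j \<Omega> f g \<longleftrightarrow> (\<forall>\<phi>. test_plane \<Omega> \<phi> \<longrightarrow>
     (LINT z:\<Omega>|lebesgue. f z * (pd_t ^^ j) ((pd_x ^^ i) \<phi>) z) =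
     (-1) ^ (i + j) * (LINT z:\<Omega>|lebesgue. g z * \<phi> z))"

definition in_W21p :: "real \<Rightarrow> (real \<times> real) set \<Rightarrow> (real \<times> real \<Rightarrow> real) \<Rightarrow> bool" where
  "in_W21p p \<Omega> f \<longleftrightarrow> in_Lp p \<Omega> f \<and>
     (\<exists>fx. in_Lp p \<Omega> fx \<and> weak_pd 1 0 \<Omega> f fx) \<and>
     (\<exists>fxx. in_Lp p \<Omega> fxx \<and> weak_pd 2 0 \<Omega> f fxx) \<and>
     (\<exists>ft. in_Lp p \<Omega> ft \<and> weak_pd 0 1 \<Omega> f ft)"

definition Linf_norm :: "real set \<Rightarrow> (real \<Rightarrow> real) \<Rightarrow> ereal" where
  "Linf_norm I h = esssup (lebesgue_on I) (\<lambda>x. ereal \<bar>h x\<bar>)"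

definition in_Linf :: "real set \<Rightarrow> (real \<Rightarrow> real) \<Rightarrow> bool" where
  "in_Linf I h \<longleftrightarrow> h \<in> borel_measurable (lebesgue_on I) \<and> Linf_norm I h < \<infinity>"

text \<open>Bochner (strong) measurability on \<open>(0,T)\<close> of the \<open>L\<^sup>\<infinity>(I)\<close>-valued map \<open>t \<mapsto> f(\<cdot>,t)\<close>: it is
  the limit, for almost every \<open>t\<close> and in the norm of \<open>L\<^sup>\<infinity>(I)\<close>, of simple functions.\<close>

definition bochner_measurable_Linf :: "real \<Rightarrow> real set \<Rightarrow> (real \<times> real \<Rightarrow> real) \<Rightarrow> bool" where
  "bochner_measurable_Linf T I f \<longleftrightarrow>
     (\<exists>(N :: nat \<Rightarrow> nat) (A :: nat \<Rightarrow> nat \<Rightarrow> real set) (h :: nat \<Rightarrow> nat \<Rightarrow> real \<Rightarrow> real).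
        (\<forall>n i. A n i \<in> sets lebesgue \<and> in_Linf I (h n i)) \<and>
        (AE t in lebesgue_on {0<..<T}.
           (\<lambda>n. Linf_norm I (\<lambda>x. f (x, t) - (\<Sum>i<N n. indicator (A n i) t * h n i x)))
             \<longlonglongrightarrow> 0))"

text \<open>\<open>L\<^sup>\<infinity>(0,T;L\<^sup>\<infinity>(I))\<close>. An element of this space is a class of \<open>L\<^sup>\<infinity>(I)\<close>-valued maps; it is
  represented here by a jointly measurable function \<open>f\<close> of \<open>(x, t)\<close>. Joint measurability is stated
  separately, because altering a function on a null set of \<open>x\<close> for each single \<open>t\<close> can destroy it.\<close>

definition in_Linf_Linf :: "real \<Rightarrow> real set \<Rightarrow> (real \<times> real \<Rightarrow> real) \<Rightarrow> bool" where
  "in_Linf_Linf T I f \<longleftrightarrow>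
     f \<in> borel_measurable (lebesgue_on (I \<times> {0<..<T})) \<and>
     bochner_measurable_Linf T I f \<and>
     esssup (lebesgue_on {0<..<T}) (\<lambda>t. Linf_norm I (\<lambda>x. f (x, t))) < \<infinity>"

text \<open>\<open>W\<^sup>1\<^sup>,\<^sup>\<infinity>(0,T;L\<^sup>\<infinity>(I))\<close>. The \<open>L\<^sup>\<infinity>(I)\<close>-valued Bochner integral of \<open>t \<mapsto> \<phi>(t) f(\<cdot>,t)\<close> has the
  representative \<open>x \<mapsto> \<integral> \<phi>(t) f(x,t) dt\<close>, so that equality of two such integrals in \<open>L\<^sup>\<infinity>(I)\<close> means
  equality for almost every \<open>x\<close>.\<close>

definition in_W1inf_Linf :: "real \<Rightarrow> real set \<Rightarrow> (real \<times> real \<Rightarrow> real) \<Rightarrow> bool" where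
  "in_W1inf_Linf T I f \<longleftrightarrow> in_Linf_Linf T I f \<and>
     (\<exists>g. in_Linf_Linf T I g \<and>
        (\<forall>\<phi>. test_line {0<..<T} \<phi> \<longrightarrow>
           (AE x in lebesgue_on I.
              (LINT t:{0<..<T}|lebesgue. f (x, t) * deriv \<phi> t) =
              - (LINT t:{0<..<T}|lebesgue. g (x, t) * \<phi> t))))"

section \<open>The nonlinearity and the initial data\<close>

text \<open>Functions on \<open>\<real>\<^sup>+ \<times> \<real>\<^sup>+\<close> are total functions whose values off the closed quadrant are
  irrelevant. Hoelder continuity is asked for on bounded subsets of the quadrant (with one
  exponent), so that unbounded nonlinearities such as \<open>F u v = u * v\<close> are included; global Hoelder
  continuity implies this.\<close>

definition admissible_F :: "(real \<Rightarrow> real \<Rightarrow> real) \<Rightarrow> bool" where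
  "admissible_F F \<longleftrightarrow>
     (\<forall>u\<ge>0. \<forall>v\<ge>0. F u v \<ge> 0) \<and>
     (\<exists>\<alpha>>0. \<forall>R>0. \<exists>L. \<forall>u\<in>{0..R}. \<forall>v\<in>{0..R}. \<forall>u'\<in>{0..R}. \<forall>v'\<in>{0..R}.
        \<bar>F u v - F u' v'\<bar> \<le> L * dist (u, v) (u', v') powr \<alpha>) \<and>
     (\<forall>u\<ge>0. F u 0 = 0) \<and> (\<forall>v\<ge>0. F 0 v = 0) \<and> (\<forall>u>0. \<forall>v>0. F u v > 0) \<and>
     (\<forall>v\<ge>0. mono_on {0..} (\<lambda>u. F u v)) \<and> (\<forall>u\<ge>0. mono_on {0..} (\<lambda>v. F u v))"

text \<open>The values at \<open>x = 0\<close> are immaterial.\<close>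

definition u0_inf :: "real \<Rightarrow> real \<Rightarrow> real" where
  "u0_inf U0 x = (if x < 0 then U0 else 0)"

definition v0_inf :: "real \<Rightarrow> real \<Rightarrow> real" where
  "v0_inf V0 x = (if x > 0 then V0 else 0)"

definition L1_norm :: "(real \<Rightarrow> real) \<Rightarrow> real" where
  "L1_norm f = (LINT x|lebesgue. \<bar>f x\<bar>)"

text \<open>\<open>k \<mapsto> w k - w_inf\<close> belongs to \<open>C(\<real>\<^sup>+, L\<^sup>1(\<real>))\<close>, where \<open>\<real>\<^sup>+ = [0,\<infinity>)\<close>, and tends to \<open>0\<close> in
  \<open>L\<^sup>1(\<real>)\<close> as \<open>k \<rightarrow> \<infinity>\<close>.\<close>

definition L1_continuous_family :: "(real \<Rightarrow> real \<Rightarrow> real) \<Rightarrow> (real \<Rightarrow> real) \<Rightarrow> bool" where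
  "L1_continuous_family w w_inf \<longleftrightarrow>
     (\<forall>k\<ge>0. integrable lebesgue (\<lambda>x. w k x - w_inf x)) \<and>
     (\<forall>k\<ge>0. ((\<lambda>l. L1_norm (\<lambda>x. (w l x - w_inf x) - (w k x - w_inf x))) \<longlongrightarrow> 0)
        (at k within {0..})) \<and>
     ((\<lambda>k. L1_norm (\<lambda>x. w k x - w_inf x)) \<longlongrightarrow> 0) at_top"

text \<open>The pointwise conditions are imposed for \<open>k > 0\<close>, the range for which the problem is posed;
  at \<open>k = 0\<close> only the conditions in \<open>L\<^sup>1\<close> are needed.\<close>

definition admissible_initial_data ::
  "real \<Rightarrow> real \<Rightarrow> real \<Rightarrow> (real \<Rightarrow> real \<Rightarrow> real) \<Rightarrow> (real \<Rightarrow> real \<Rightarrow> real) \<Rightarrow> bool" where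
  "admissible_initial_data U0 V0 M u0 v0 \<longleftrightarrow>
     (\<forall>k>0. C2_real (u0 k) \<and> C2_real (v0 k)) \<and>
     (\<forall>k>0. \<forall>x. 0 \<le> u0 k x \<and> u0 k x \<le> M \<and> 0 \<le> v0 k x \<and> v0 k x \<le> M) \<and>
     (\<forall>k>0. (u0 k \<longlongrightarrow> U0) at_bot \<and> (u0 k \<longlongrightarrow> 0) at_top \<and>
             (v0 k \<longlongrightarrow> 0) at_bot \<and> (v0 k \<longlongrightarrow> V0) at_top) \<and>
     L1_continuous_family u0 (u0_inf U0) \<and> L1_continuous_family v0 (v0_inf V0) \<and>
     (\<exists>\<omega>. continuous_on {0..} \<omega> \<and> (\<forall>\<mu>\<ge>0. \<omega> \<mu> \<ge> 0) \<and> (\<omega> \<longlongrightarrow> 0) (at_right 0) \<and>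
        (\<forall>k>0. \<forall>\<xi>. L1_norm (\<lambda>x. u0 k (x + \<xi>) - u0 k x) + L1_norm (\<lambda>x. v0 k (x + \<xi>) - v0 k x)
           \<le> \<omega> \<bar>\<xi>\<bar>))"

section \<open>Solutions\<close>

text \<open>In the following definitions \<open>a\<close> and \<open>b\<close> are the initial values of \<open>u\<close> and \<open>v\<close>.\<close>

definition classical_solution ::
  "real \<Rightarrow> real \<Rightarrow> real \<Rightarrow> real \<Rightarrow> (real \<Rightarrow> real \<Rightarrow> real) \<Rightarrow> (real \<Rightarrow> real) \<Rightarrow> (real \<Rightarrow> real) \<Rightarrow>
   (real \<times> real \<Rightarrow> real) \<Rightarrow> (real \<times> real \<Rightarrow> real) \<Rightarrow> bool" where
  "classical_solution T du dv k F a b u v \<longleftrightarrow>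
     (\<exists>ux uxx ut vx vxx vt.
        (\<forall>\<delta>. 0 < \<delta> \<and> \<delta> < T \<longrightarrow> C21_strip \<delta> T u ux uxx ut \<and> C21_strip \<delta> T v vx vxx vt) \<and>
        (\<forall>z\<in>QT T. ut z = du * uxx z - k * F (u z) (v z)) \<and>
        (\<forall>z\<in>QT T. vt z = dv * vxx z - k * F (u z) (v z))) \<and>
     continuous_on (UNIV \<times> {0..T}) u \<and> continuous_on (UNIV \<times> {0..T}) v \<and>
     (\<forall>J>0. \<forall>p\<ge>1. in_W21p p ({-J<..<J} \<times> {0<..<T}) u \<and> in_W21p p ({-J<..<J} \<times> {0<..<T}) v) \<and>
     (\<forall>x. u (x, 0) = a x) \<and> (\<forall>x. v (x, 0) = b x)"

definition weak_solution ::
  "real \<Rightarrow> real \<Rightarrow> real \<Rightarrow> (real \<Rightarrow> real \<Rightarrow> real) \<Rightarrow> (real \<Rightarrow> real) \<Rightarrow> (real \<Rightarrow> real) \<Rightarrow>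
   (real \<times> real \<Rightarrow> real) \<Rightarrow> (real \<times> real \<Rightarrow> real) \<Rightarrow> bool" where
  "weak_solution T du k F a b u v \<longleftrightarrow>
     (\<forall>J>0. \<forall>p\<ge>1. in_W21p p ({-J<..<J} \<times> {0<..<T}) u) \<and>
     (\<forall>J>0. in_W1inf_Linf T {-J<..<J} v) \<and>
     (\<forall>\<psi> \<psi>x \<psi>xx \<psi>t. C21_strip 0 T \<psi> \<psi>x \<psi>xx \<psi>t \<and> (\<forall>x. \<psi> (x, T) = 0) \<and>
        (\<exists>J>0. \<forall>x. \<forall>t\<in>{0..T}. \<psi> (x, t) \<noteq> 0 \<longrightarrow> x \<in> {-J..J}) \<longrightarrow>
        (LINT z:QT T|lebesgue. u z * \<psi>t z) +
        (LINT z:QT T|lebesgue. du * u z * \<psi>xx z - k * F (u z) (v z) * \<psi> z)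
          = - (LINT x|lebesgue. a x * \<psi> (x, 0)) \<and>
        (LINT z:QT T|lebesgue. v z * \<psi>t z) - (LINT z:QT T|lebesgue. k * F (u z) (v z) * \<psi> z)
          = - (LINT x|lebesgue. b x * \<psi> (x, 0)))"

definition solution ::
  "real \<Rightarrow> real \<Rightarrow> real \<Rightarrow> real \<Rightarrow> (real \<Rightarrow> real \<Rightarrow> real) \<Rightarrow> (real \<Rightarrow> real) \<Rightarrow> (real \<Rightarrow> real) \<Rightarrow>
   (real \<times> real \<Rightarrow> real) \<Rightarrow> (real \<times> real \<Rightarrow> real) \<Rightarrow> bool" where
  "solution T du dv k F a b u v \<longleftrightarrow>
     (dv > 0 \<and> classical_solution T du dv k F a b u v) \<or>
     (dv = 0 \<and> weak_solution T du k F a b u v)"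

end

theory Submission
  imports Defs
begin

text \<open>Each reaction integral is controlled where the corresponding species is initially almost absent.
  Since \<open>v\<^sub>0\<^sup>\<infinity> = 0\<close> for \<open>x < 0\<close>, testing the equation for \<open>v\<close> with a cut-off of the left half-line
  bounds \<open>\<integral>\<integral> k F(u,v)\<close> there by the initial mass of \<open>v\<close> under the cut-off plus \<open>d\<^sub>v M T\<close> times the \<open>L\<^sup>1\<close> norm of
  the second derivative of the cut-off, which does not grow with the length of its plateau. The
  equation for \<open>u\<close> does the same on the right half-line.\<close>

section \<open>Cut-off functions\<close>

text \<open>No decay of the gradients at spatial infinity is available, so every cut-off has compact
  support, and the plateau is widened afterwards by Fatou's lemma for the nonnegative reaction term.
  Time needs a second approximation: for \<open>dv = 0\<close> test functions must vanish at
  \<open>T\<close>, and for \<open>dv > 0\<close> the derivatives are controlled only away from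
  \<open>t = 0\<close>. In both cases the contribution of later times has a favourable sign because
  \<open>u\<close> and \<open>v\<close> are nonnegative, and it is dropped.

  A smooth cut-off has to enter the opposite half-line on a ramp of unit length. There the limiting
  initial value is \<open>U0\<close> or \<open>V0\<close>, so this overshoot adds \<open>U0\<close>
  or \<open>V0\<close> to the constant. What remains of the initial mass is an \<open>L^1\<close>
  distance to the step data, bounded uniformly in \<open>k\<close> because it depends continuously
  on \<open>k\<close> and tends to 0. The estimates use extended nonnegative integrals, so
  finiteness is part of the conclusion.\<close>

lemma has_real_derivative_If_le:
  fixes f g :: "real \<Rightarrow> real"
  assumes f: "\<And>y. y \<le> c \<Longrightarrow> (f has_real_derivative f' y) (at y)"
    and g: "\<And>y. c \<le> y \<Longrightarrow> (g has_real_derivative g' y) (at y)"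
    and eq: "f c = g c" "f' c = g' c"
  shows "((\<lambda>y. if y \<le> c then f y else g y) has_real_derivative (if x \<le> c then f' x else g' x)) (at x)"
proof -
  have "((\<lambda>y. if y \<in> {..c} then f y else g y) has_vector_derivative
      (if x \<in> {..c} then f' x else g' x)) (at x within UNIV)"
  \<comment> \<open>The closures of the two half-lines meet only in \<open>c\<close>, so values and
    slopes have to match only there.\<close>
  proof (rule has_vector_derivative_If_within_closures[where T = "{c<..}"])
    show "x \<in> {..c} \<union> {c<..}" "UNIV = {..c} \<union> {c<..}" by auto
  qed (use f g eq in \<open>auto simp: has_real_derivative_iff_has_vector_derivative
         intro: has_vector_derivative_at_within\<close>)
  then show ?thesis by (simp add: has_real_derivative_iff_has_vector_derivative)
qed

text \<open>The quintic Hermite step: the unique quintic with values 0 and 1 at 0 and 1 whose first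
  and second derivatives vanish at both ends. Gluing it to constants thus gives a C^2 function, as
  the weak formulation demands of its test functions.\<close>

definition smoothstep :: "real \<Rightarrow> real" where
  "smoothstep x = (if x \<le> 0 then 0 else if x \<le> 1 then 10 * x^3 - 15 * x^4 + 6 * x^5 else 1)"

definition smoothstep' :: "real \<Rightarrow> real" where
  "smoothstep' x = (if x \<le> 0 then 0 else if x \<le> 1 then 30 * x^2 - 60 * x^3 + 30 * x^4 else 0)"

definition smoothstep'' :: "real \<Rightarrow> real" where
  "smoothstep'' x = (if x \<le> 0 then 0 else if x \<le> 1 then 60 * x - 180 * x^2 + 120 * x^3 else 0)"

lemma smoothstep_deriv: "(smoothstep has_real_derivative smoothstep' x) (at x)"
  unfolding smoothstep_def[abs_def] smoothstep'_def
proof (rule has_real_derivative_If_le)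
  fix y :: real assume "0 \<le> y"
  show "((\<lambda>y. if y \<le> 1 then 10 * y^3 - 15 * y^4 + 6 * y^5 else 1) has_real_derivative
      (if y \<le> 1 then 30 * y^2 - 60 * y^3 + 30 * y^4 else 0)) (at y)"
    by (rule has_real_derivative_If_le) (auto intro!: derivative_eq_intros)
qed (auto intro!: derivative_eq_intros)

lemma smoothstep'_deriv: "(smoothstep' has_real_derivative smoothstep'' x) (at x)"
  unfolding smoothstep'_def[abs_def] smoothstep''_def
proof (rule has_real_derivative_If_le)
  fix y :: real assume "0 \<le> y"
  show "((\<lambda>y. if y \<le> 1 then 30 * y^2 - 60 * y^3 + 30 * y^4 else 0) has_real_derivative
      (if y \<le> 1 then 60 * y - 180 * y^2 + 120 * y^3 else 0)) (at y)"
    by (rule has_real_derivative_If_le) (auto intro!: derivative_eq_intros)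
qed (auto intro!: derivative_eq_intros)

lemma smoothstep''_continuous: "continuous_on UNIV smoothstep''"
proof -
  \<comment> \<open>Clamping to [0,1] replaces the case distinction, because 60 y - 180 y^2 + 120
    y^3 vanishes at y = 0 and at y = 1.\<close>
  have eq: "smoothstep'' x = 60 * max 0 (min 1 x) - 180 * (max 0 (min 1 x))^2 + 120 * (max 0 (min 1 x))^3" for x
    by (auto simp: smoothstep''_def max_def min_def)
  show ?thesis by (subst continuous_on_cong[OF refl eq]) (auto intro!: continuous_intros)
qed

lemma smoothstep_0 [simp]: "x \<le> 0 \<Longrightarrow> smoothstep x = 0" and smoothstep_1 [simp]: "1 \<le> x \<Longrightarrow> smoothstep x = 1"
  by (auto simp: smoothstep_def)

lemma smoothstep'_0: "x \<le> 0 \<or> 1 \<le> x \<Longrightarrow> smoothstep' x = 0"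
  and smoothstep''_0: "x \<le> 0 \<or> 1 \<le> x \<Longrightarrow> smoothstep'' x = 0"
  by (cases "x = 1"; auto simp: smoothstep'_def smoothstep''_def)+

lemma mono_smoothstep: "x \<le> y \<Longrightarrow> smoothstep x \<le> smoothstep y"
proof (rule DERIV_nonneg_imp_nondecreasing[where f = smoothstep])
  fix z :: real
  have "30 * z^2 - 60 * z^3 + 30 * z^4 = 30 * (z * (1 - z))^2"
    by (simp add: algebra_simps power2_eq_square power3_eq_cube power_numeral_reduce)
  then have "0 \<le> smoothstep' z" by (simp add: smoothstep'_def)
  then show "\<exists>d. (smoothstep has_real_derivative d) (at z) \<and> 0 \<le> d" using smoothstep_deriv by blast
qed

text \<open>On [0,1] the polynomial is 60 x (1 - x) (1 - 2 x), and the factors x, 1 - x and 1 - 2 x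
  have modulus at most 1.\<close>

lemma abs_smoothstep''_le: "\<bar>smoothstep'' x\<bar> \<le> 60 * indicator {0..1} x"
proof (cases "x \<in> {0..1}")
  case True
  have "60 * x - 180 * x^2 + 120 * x^3 = 60 * (x * ((1 - x) * (1 - 2*x)))"
    by (simp add: algebra_simps power2_eq_square power3_eq_cube)
  then have "\<bar>60 * x - 180 * x^2 + 120 * x^3\<bar> = 60 * (\<bar>x\<bar> * (\<bar>1 - x\<bar> * \<bar>1 - 2*x\<bar>))"
    by (simp add: abs_mult)
  also have "\<dots> \<le> 60 * (1 * (1 * 1))" using True by (intro mult_mono) auto
  finally show ?thesis using True by (auto simp: smoothstep''_def)
qed (auto simp: smoothstep''_def)

section \<open>Plateau functions with two ramps of unit length\<close>

definition plateau :: "real \<Rightarrow> real \<Rightarrow> real \<Rightarrow> real" where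
  "plateau a b x = smoothstep (x - a) - smoothstep (x - b)"

definition plateau' :: "real \<Rightarrow> real \<Rightarrow> real \<Rightarrow> real" where
  "plateau' a b x = smoothstep' (x - a) - smoothstep' (x - b)"

definition plateau'' :: "real \<Rightarrow> real \<Rightarrow> real \<Rightarrow> real" where
  "plateau'' a b x = smoothstep'' (x - a) - smoothstep'' (x - b)"

lemma plateau_deriv: "(plateau a b has_real_derivative plateau' a b x) (at x)"
  unfolding plateau_def[abs_def] plateau'_def
  by (auto intro!: derivative_eq_intros DERIV_chain2[OF smoothstep_deriv])

lemma plateau'_deriv: "(plateau' a b has_real_derivative plateau'' a b x) (at x)"
  unfolding plateau'_def[abs_def] plateau''_def
  by (auto intro!: derivative_eq_intros DERIV_chain2[OF smoothstep'_deriv])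

lemma plateau''_continuous: "continuous_on UNIV (plateau'' a b)"
  unfolding plateau''_def
  by (intro continuous_intros continuous_on_compose2[OF smoothstep''_continuous]) auto

lemma plateau_bounds: "a \<le> b \<Longrightarrow> 0 \<le> plateau a b x" "plateau a b x \<le> 1"
proof -
  have rng: "0 \<le> smoothstep y \<and> smoothstep y \<le> 1" for y
    using mono_smoothstep[of 0 y] mono_smoothstep[of y 1] by (cases "y \<le> 0"; cases "y \<le> 1") auto
  show "0 \<le> plateau a b x" if "a \<le> b"
    using mono_smoothstep[of "x - b" "x - a"] that by (simp add: plateau_def)
  show "plateau a b x \<le> 1"
    using rng[of "x - a"] rng[of "x - b"] by (simp add: plateau_def)
qed

lemma plateau_eq_0: "x \<le> a \<or> b + 1 \<le> x \<Longrightarrow> a \<le> b \<Longrightarrow> plateau a b x = 0"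
  and plateau_eq_1: "a + 1 \<le> x \<Longrightarrow> x \<le> b \<Longrightarrow> plateau a b x = 1"
  by (auto simp: plateau_def)

text \<open>Each ramp has length 1 and contributes at most 60, whatever the distance between
  \<open>a\<close> and \<open>b\<close>. This is the origin of the factor 120 in the final
  constants.\<close>

lemma nn_integral_abs_plateau'': "(\<integral>\<^sup>+x. ennreal \<bar>plateau'' a b x\<bar> \<partial>lborel) \<le> ennreal 120"
proof -
  have "ennreal \<bar>plateau'' a b x\<bar> \<le> 60 * indicator {a..a+1} x + 60 * indicator {b..b+1} x" for x
  proof -
    have "\<bar>plateau'' a b x\<bar> \<le> 60 * indicator {0..1} (x - a) + 60 * indicator {0..1} (x - b)"
      unfolding plateau''_def using abs_smoothstep''_le[of "x - a"] abs_smoothstep''_le[of "x - b"] by linarith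
    also have "ennreal \<dots> = 60 * indicator {a..a+1} x + 60 * indicator {b..b+1} x"
      by (auto simp: indicator_def simp flip: ennreal_plus)
    finally show ?thesis by (simp add: ennreal_leI)
  qed
  then have "(\<integral>\<^sup>+x. ennreal \<bar>plateau'' a b x\<bar> \<partial>lborel)
      \<le> (\<integral>\<^sup>+x. 60 * indicator {a..a+1} x + 60 * indicator {b..b+1} x \<partial>lborel)"
    by (intro nn_integral_mono)
  also have "\<dots> = 120" by (subst nn_integral_add) (auto simp: nn_integral_cmult)
  finally show ?thesis by simp
qed

section \<open>Measurability and integration on the strip\<close>

text \<open>The norm is continuous in \<open>k\<close> and has a limit at infinity: compactness
  bounds it on an initial interval, the limit bounds it beyond.\<close>

lemma L1_continuous_family_bounded:
  assumes "L1_continuous_family w w_inf"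
  shows "\<exists>K. \<forall>k\<ge>0. L1_norm (\<lambda>x. w k x - w_inf x) \<le> K"
proof -
  define N where "N k = L1_norm (\<lambda>x. w k x - w_inf x)" for k
  have int: "integrable lebesgue (\<lambda>x. w k x - w_inf x)" if "k \<ge> 0" for k
    using assms that by (auto simp: L1_continuous_family_def)
  \<comment> \<open>The reverse triangle inequality carries continuity of the family over to its
    norm.\<close>
  have lip: "\<bar>N l - N k\<bar> \<le> L1_norm (\<lambda>x. (w l x - w_inf x) - (w k x - w_inf x))" if "k \<ge> 0" "l \<ge> 0" for k l
  proof -
    have "N l - N k = (LINT x|lebesgue. \<bar>w l x - w_inf x\<bar> - \<bar>w k x - w_inf x\<bar>)"
      unfolding N_def L1_norm_def using int that by simp
    also have "\<bar>\<dots>\<bar> \<le> (LINT x|lebesgue. \<bar>\<bar>w l x - w_inf x\<bar> - \<bar>w k x - w_inf x\<bar>\<bar>)"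
      by (rule integral_abs_bound)
    also have "\<dots> \<le> L1_norm (\<lambda>x. (w l x - w_inf x) - (w k x - w_inf x))"
      unfolding L1_norm_def using int that
      by (intro integral_mono integrable_abs Bochner_Integration.integrable_diff[of lebesgue "\<lambda>x. \<bar>w l x - w_inf x\<bar>"]
          Bochner_Integration.integrable_diff[of lebesgue "\<lambda>x. w l x - w_inf x"]) auto
    finally show ?thesis .
  qed
  have "continuous_on {0..} N"
    unfolding continuous_on_def
  proof (intro ballI)
    fix k :: real assume k: "k \<in> {0..}"
    have "((\<lambda>l. N l - N k) \<longlongrightarrow> 0) (at k within {0..})"
    proof (rule Lim_null_comparison)
      show "\<forall>\<^sub>F l in at k within {0..}. norm (N l - N k) \<le> L1_norm (\<lambda>x. (w l x - w_inf x) - (w k x - w_inf x))"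
        using lip k by (auto simp: eventually_at_filter)
    qed (use assms k in \<open>auto simp: L1_continuous_family_def\<close>)
    then show "(N \<longlongrightarrow> N k) (at k within {0..})" by (simp add: LIM_zero_iff)
  qed
  have "\<forall>\<^sub>F k in at_top. N k < 1"
    using assms by (intro order_tendstoD[where y = 0]) (auto simp: L1_continuous_family_def N_def)
  then obtain R where R: "\<And>k. k \<ge> R \<Longrightarrow> N k < 1" by (auto simp: eventually_at_top_linorder)
  have "bounded (N ` {0..max 0 R})"
    using \<open>continuous_on {0..} N\<close> by (intro compact_imp_bounded compact_continuous_image)
      (auto elim: continuous_on_subset)
  then obtain B where B: "\<And>k. k \<in> {0..max 0 R} \<Longrightarrow> \<bar>N k\<bar> \<le> B"
    unfolding bounded_iff by fastforce
  have "N k \<le> max B 1" if "k \<ge> 0" for k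
  proof (cases "k \<le> R")
    case True
    then show ?thesis using B[of k] that by fastforce
  next
    case False
    then show ?thesis using R[of k] by fastforce
  qed
  then show ?thesis unfolding N_def by blast
qed

text \<open>Tonelli for the completed measure, where single sections of \<open>f\<close> may be
  nonmeasurable. A Borel representative \<open>g\<close> and a Borel null set \<open>N\<close>
  containing the discrepancy reduce it to the Borel case, since almost every section of
  \<open>N\<close> is null.\<close>

lemma nn_integral_lebesgue_iterated:
  fixes f :: "real \<times> real \<Rightarrow> ennreal"
  assumes "f \<in> borel_measurable lebesgue"
  shows "(\<integral>\<^sup>+t. (\<integral>\<^sup>+x. f (x, t) \<partial>lebesgue) \<partial>lebesgue) = (\<integral>\<^sup>+z. f z \<partial>lebesgue)"
proof -
  obtain g where g[measurable]: "g \<in> borel_measurable lborel" and ae: "AE z in lborel. f z = g z"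
    using completion_ex_borel_measurable[OF assms] by blast
  have g': "g \<in> borel_measurable (lborel \<Otimes>\<^sub>M lborel)" by (simp add: lborel_prod)
  obtain N where N: "N \<in> null_sets lborel" "{z. f z \<noteq> g z} \<subseteq> N"
    using ae by (auto elim!: AE_E simp: null_sets_def)
  have "AE z in lborel. z \<notin> N" using N(1) by (rule AE_not_in)
  then have "AE z in lborel \<Otimes>\<^sub>M lborel. z \<notin> N" unfolding lborel_prod .
  then have "AE x in lborel. AE t in lborel. (x, t) \<notin> N" by (rule lborel_pair.AE_pair)
  \<comment> \<open>\<open>AE_pair\<close> fixes \<open>x\<close> first, but the inner integral runs
    over \<open>x\<close>. Exchanging the two quantifiers requires a Borel exceptional set.\<close>
  moreover have "{z \<in> space (lborel \<Otimes>\<^sub>M lborel). (fst z, snd z) \<notin> N} \<in> sets (lborel \<Otimes>\<^sub>M lborel)"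
    using N(1) unfolding lborel_prod by (auto simp: null_sets_def simp flip: Compl_eq)
  ultimately have "AE t in lborel. AE x in lborel. (x, t) \<notin> N"
    by (subst (asm) lborel_pair.AE_commute) auto
  then have "AE t in lborel. AE x in lborel. f (x, t) = g (x, t)"
    using N(2) by (auto elim!: eventually_mono)
  then have "(\<integral>\<^sup>+t. (\<integral>\<^sup>+x. f (x, t) \<partial>lborel) \<partial>lborel) = (\<integral>\<^sup>+t. (\<integral>\<^sup>+x. g (x, t) \<partial>lborel) \<partial>lborel)"
    by (intro nn_integral_cong_AE) (auto elim!: eventually_mono intro!: nn_integral_cong_AE)
  also have "\<dots> = (\<integral>\<^sup>+z. g z \<partial>lborel)" using lborel_pair.nn_integral_snd[OF g'] by (simp add: lborel_prod)
  also have "\<dots> = (\<integral>\<^sup>+z. f z \<partial>lborel)" using ae by (intro nn_integral_cong_AE) auto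
  finally show ?thesis by (simp add: nn_integral_completion)
qed

text \<open>Fatou's lemma in the form that removes each truncation below: time factors, space-time
  boxes, plateaus.\<close>

lemma nn_integral_le_limit:
  assumes "\<And>n. f n \<in> borel_measurable M"
    and "\<And>x. x \<in> space M \<Longrightarrow> g x \<le> liminf (\<lambda>n. f n x)"
    and "\<And>n. (\<integral>\<^sup>+x. f n x \<partial>M) \<le> c n" and "c \<longlonglongrightarrow> C"
  shows "(\<integral>\<^sup>+x. g x \<partial>M) \<le> C"
proof -
  have "(\<integral>\<^sup>+x. g x \<partial>M) \<le> (\<integral>\<^sup>+x. liminf (\<lambda>n. f n x) \<partial>M)"
    using assms(2) by (rule nn_integral_mono)
  also have "\<dots> \<le> liminf (\<lambda>n. \<integral>\<^sup>+x. f n x \<partial>M)"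
    using assms(1) by (rule nn_integral_liminf)
  also have "\<dots> \<le> liminf c" using assms(3) by (intro Liminf_mono) simp
  also have "\<dots> = C" using assms(4) by (intro lim_imp_Liminf) auto
  finally show ?thesis .
qed

lemma QT_sets [measurable]: "QT T \<in> sets borel" "QT T \<in> sets lebesgue"
proof -
  have "open (QT T)" unfolding QT_def by (intro open_Times) auto
  then show "QT T \<in> sets borel" "QT T \<in> sets lebesgue" by auto
qed

lemma borel_measurable_lebesgue_onI:
  assumes "f \<in> borel_measurable borel"
  shows "f \<in> borel_measurable (lebesgue_on S)"
proof -
  have "f \<in> borel_measurable lebesgue" using assms by (intro measurable_completion) simp
  then show ?thesis by (rule measurable_restrict_space1)
qed

text \<open>Supplies majorants on the unbounded strip: integrating a function of \<open>x\<close>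
  alone over time only contributes the factor \<open>T\<close>.\<close>

lemma integral_QT_fst:
  fixes h :: "real \<Rightarrow> real"
  assumes "0 < T" "integrable lborel h"
  shows "integrable (lebesgue_on (QT T)) (\<lambda>z. h (fst z))"
    and "(LINT z|lebesgue_on (QT T). \<bar>h (fst z)\<bar>) = T * (LINT x|lborel. \<bar>h x\<bar>)"
proof -
  have [measurable]: "h \<in> borel_measurable borel" using assms(2) by auto
  have hf: "(\<lambda>z::real \<times> real. h (fst z)) \<in> borel_measurable borel" 
    unfolding borel_prod[symmetric] by measurable
  then have meas: "(\<lambda>z. h (fst z)) \<in> borel_measurable (lebesgue_on (QT T))"
    by (rule borel_measurable_lebesgue_onI)
  have fin: "(\<integral>\<^sup>+x. ennreal \<bar>h x\<bar> \<partial>lborel) = ennreal (LINT x|lborel. \<bar>h x\<bar>)"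
    using assms(2) by (intro nn_integral_eq_integral) auto
  have "(\<integral>\<^sup>+z. ennreal \<bar>h (fst z)\<bar> \<partial>lebesgue_on (QT T)) = (\<integral>\<^sup>+z. ennreal \<bar>h (fst z)\<bar> * indicator (QT T) z \<partial>lebesgue)"
    by (simp add: nn_integral_restrict_space)
  also have "\<dots> = (\<integral>\<^sup>+t. (\<integral>\<^sup>+x. ennreal \<bar>h x\<bar> * indicator {0<..<T} t \<partial>lebesgue) \<partial>lebesgue)"
  proof (subst nn_integral_lebesgue_iterated[symmetric])
    show "(\<lambda>z. ennreal \<bar>h (fst z)\<bar> * indicator (QT T) z) \<in> borel_measurable lebesgue"
      using hf by (intro measurable_completion) simp
  qed (auto intro!: nn_integral_cong simp: QT_def indicator_def)
  also have "\<dots> = (\<integral>\<^sup>+t. ennreal (LINT x|lborel. \<bar>h x\<bar>) * indicator {0<..<T} t \<partial>lborel)"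
    by (simp add: nn_integral_completion nn_integral_multc fin)
  also have "\<dots> = ennreal (LINT x|lborel. \<bar>h x\<bar>) * ennreal T"
    using assms(1) by (simp add: nn_integral_cmult)
  also have "\<dots> = ennreal (T * (LINT x|lborel. \<bar>h x\<bar>))" using assms(1) by (simp add: ennreal_mult' ennreal_mult'' mult.commute)
  finally have eq: "(\<integral>\<^sup>+z. ennreal \<bar>h (fst z)\<bar> \<partial>lebesgue_on (QT T)) = ennreal (T * (LINT x|lborel. \<bar>h x\<bar>))" .
  show "integrable (lebesgue_on (QT T)) (\<lambda>z. h (fst z))"
    using meas eq by (auto simp: integrable_iff_bounded)
  show "(LINT z|lebesgue_on (QT T). \<bar>h (fst z)\<bar>) = T * (LINT x|lborel. \<bar>h x\<bar>)"
    using meas eq assms(1) by (subst integral_eq_nn_integral) auto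
qed

section \<open>The nonlinearity on bounded densities\<close>

lemma admissible_F_continuous_on:
  assumes "admissible_F F" "M > 0"
  shows "continuous_on ({0..M} \<times> {0..M}) (\<lambda>z. F (fst z) (snd z))"
proof -
  from assms(1) obtain \<alpha> where \<alpha>: "\<alpha> > 0" and hoelder: "\<forall>R>0. \<exists>L. \<forall>u\<in>{0..R}. \<forall>v\<in>{0..R}.
      \<forall>u'\<in>{0..R}. \<forall>v'\<in>{0..R}. \<bar>F u v - F u' v'\<bar> \<le> L * dist (u, v) (u', v') powr \<alpha>"
    unfolding admissible_F_def by (elim conjE exE)
  from hoelder assms(2) obtain L where L: "\<forall>u\<in>{0..M}. \<forall>v\<in>{0..M}.
      \<forall>u'\<in>{0..M}. \<forall>v'\<in>{0..M}. \<bar>F u v - F u' v'\<bar> \<le> L * dist (u, v) (u', v') powr \<alpha>"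
    by blast
  show ?thesis unfolding continuous_on_def
  proof
    fix z assume z: "z \<in> {0..M} \<times> {0..M}"
    have "((\<lambda>y. F (fst y) (snd y) - F (fst z) (snd z)) \<longlongrightarrow> 0) (at z within {0..M} \<times> {0..M})"
    proof (rule Lim_null_comparison)
      show "\<forall>\<^sub>F y in at z within {0..M} \<times> {0..M}.
          norm (F (fst y) (snd y) - F (fst z) (snd z)) \<le> L * dist y z powr \<alpha>"
      proof -
        have "norm (F (fst y) (snd y) - F (fst z) (snd z)) \<le> L * dist y z powr \<alpha>"
          if "y \<in> {0..M} \<times> {0..M}" for y
          using L[rule_format, of "fst y" "snd y" "fst z" "snd z"] that z by (simp add: mem_Times_iff)
        then show ?thesis by (simp add: eventually_at_filter)
      qed
      have "((\<lambda>y. L * dist y z powr \<alpha>) \<longlongrightarrow> L * dist z z powr \<alpha>) (at z within {0..M} \<times> {0..M})"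
        using \<alpha> by (intro tendsto_intros tendsto_powr') auto
      then show "((\<lambda>y. L * dist y z powr \<alpha>) \<longlongrightarrow> 0) (at z within {0..M} \<times> {0..M})" by simp
    qed
    then show "((\<lambda>y. F (fst y) (snd y)) \<longlongrightarrow> F (fst z) (snd z)) (at z within {0..M} \<times> {0..M})"
      by (simp add: LIM_zero_iff)
  qed
qed

lemma admissible_F_bounds:
  assumes "admissible_F F" "u \<in> {0..M}" "v \<in> {0..M}"
  shows "0 \<le> F u v" "F u v \<le> F M M"
proof -
  show "0 \<le> F u v" using assms by (auto simp: admissible_F_def)
  have "F u v \<le> F M v" using assms by (auto simp: admissible_F_def mono_on_def)
  also have "F M v \<le> F M M" using assms by (auto simp: admissible_F_def mono_on_def)
  finally show "F u v \<le> F M M" .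
qed

text \<open>\<open>F\<close> is regular only on the quadrant, and \<open>u\<close>, \<open>v\<close>
  stay in it only almost everywhere. Clamping both arguments to [0,M] yields a continuous function
  on the plane; completeness of Lebesgue measure then transfers measurability across the null
  set.\<close>

lemma admissible_F_measurable:
  assumes F: "admissible_F F" and M: "M > 0"
    and u: "u \<in> borel_measurable (lebesgue_on S)" and v: "v \<in> borel_measurable (lebesgue_on S)"
    and S: "S \<in> sets lebesgue"
    and ae: "AE z in lebesgue_on S. 0 \<le> u z \<and> u z \<le> M \<and> 0 \<le> v z \<and> v z \<le> M"
  shows "(\<lambda>z. F (u z) (v z)) \<in> borel_measurable (lebesgue_on S)"
proof -
  define c where "c = (\<lambda>x. max 0 (min M x))"
  have "continuous_on UNIV (\<lambda>p::real \<times> real. (c (fst p), c (snd p)))"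
    unfolding c_def by (intro continuous_intros)
  moreover have "(c (fst p), c (snd p)) \<in> {0..M} \<times> {0..M}" for p :: "real \<times> real"
    using M by (auto simp: c_def)
  ultimately have "continuous_on UNIV (\<lambda>p::real \<times> real. F (c (fst p)) (c (snd p)))"
    using continuous_on_compose2[OF admissible_F_continuous_on[OF F M], of UNIV "\<lambda>p. (c (fst p), c (snd p))"]
    by fastforce
  then have "(\<lambda>p. F (c (fst p)) (c (snd p))) \<in> borel_measurable borel"
    by (rule borel_measurable_continuous_onI)
  then have "(\<lambda>z. F (c (u z)) (c (v z))) \<in> borel_measurable (lebesgue_on S)"
    using measurable_compose[OF borel_measurable_Pair[OF u v], of "\<lambda>p. F (c (fst p)) (c (snd p))" borel] by simp
  then have "(\<lambda>z. if z \<in> S then F (c (u z)) (c (v z)) else 0) \<in> borel_measurable lebesgue"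
    using S by (simp add: borel_measurable_if)
  moreover have "AE z in lebesgue. (if z \<in> S then F (c (u z)) (c (v z)) else 0) = (if z \<in> S then F (u z) (v z) else 0)"
    using ae S by (subst (asm) AE_restrict_space_iff) (auto simp: c_def elim!: eventually_mono)
  ultimately have "(\<lambda>z. if z \<in> S then F (u z) (v z) else 0) \<in> borel_measurable lebesgue"
    by (rule borel_measurable_AE)
  then show ?thesis using S by (simp add: borel_measurable_if)
qed

lemma C21_strip_subinterval:
  assumes "C21_strip a b f fx fxx ft" "a \<le> a'" "b' \<le> b"
  shows "C21_strip a' b' f fx fxx ft"
proof -
  have sub: "UNIV \<times> {a'..b'} \<subseteq> (UNIV :: real set) \<times> {a..b}" "{a'..b'} \<subseteq> {a..b}" using assms by auto
  have "((\<lambda>s. f (x, s)) has_real_derivative ft (x, t)) (at t within {a'..b'})" if "t \<in> {a'..b'}" for x t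
    using assms(1) sub(2) that unfolding C21_strip_def by (intro DERIV_subset[OF _ sub(2)]) auto
  moreover have "continuous_on (UNIV \<times> {a'..b'}) f" "continuous_on (UNIV \<times> {a'..b'}) fx"
    "continuous_on (UNIV \<times> {a'..b'}) fxx" "continuous_on (UNIV \<times> {a'..b'}) ft"
    using assms(1) unfolding C21_strip_def by (auto intro: continuous_on_subset[OF _ sub(1)])
  ultimately show ?thesis using assms(1) sub(2) unfolding C21_strip_def by auto
qed

section \<open>Testing a scalar equation with a cut-off\<close>

text \<open>\<open>A\<close> bounds the total variation of \<open>\<phi>'\<close>. The estimates for
  the reaction term depend on \<open>A\<close> but not on the half-width \<open>J\<close>, so the
  plateau can be widened at no cost. The support condition includes \<open>J\<close> and
  \<open>-J\<close> themselves, which kills boundary terms there.\<close>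

locale cutoff =
  fixes J A :: real and \<phi> \<phi>' \<phi>'' :: "real \<Rightarrow> real"
  assumes deriv: "(\<phi> has_real_derivative \<phi>' x) (at x)"
    and deriv': "(\<phi>' has_real_derivative \<phi>'' x) (at x)"
    and continuous'': "continuous_on UNIV \<phi>''"
    and nonneg: "0 \<le> \<phi> x" and le_1: "\<phi> x \<le> 1"
    and support: "J \<le> \<bar>x\<bar> \<Longrightarrow> \<phi> x = 0" "J \<le> \<bar>x\<bar> \<Longrightarrow> \<phi>' x = 0" "J \<le> \<bar>x\<bar> \<Longrightarrow> \<phi>'' x = 0"
    and J_pos: "0 < J" and A_nonneg: "0 \<le> A"
    and variation: "(\<integral>\<^sup>+x. ennreal \<bar>\<phi>'' x\<bar> \<partial>lborel) \<le> ennreal A"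
begin

lemma continuous: "continuous_on S \<phi>" and continuous': "continuous_on S \<phi>'" and continuous''_on: "continuous_on S \<phi>''"
proof -
  show "continuous_on S \<phi>" "continuous_on S \<phi>'"
    using deriv deriv' by (meson DERIV_isCont continuous_at_imp_continuous_on)+
  show "continuous_on S \<phi>''" using continuous'' continuous_on_subset by blast
qed

lemma measurable [measurable]:
  "\<phi> \<in> borel_measurable borel" "\<phi>'' \<in> borel_measurable borel"
  using continuous continuous''_on by (auto intro: borel_measurable_continuous_onI)

lemma integrable'': "integrable lborel \<phi>''"
  using variation by (auto simp: integrable_iff_bounded intro: le_less_trans)

lemma integral_abs'': "(LINT x|lborel. \<bar>\<phi>'' x\<bar>) \<le> A"
  using variation A_nonneg by (subst integral_eq_nn_integral) (auto intro: enn2real_leI)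

lemma integrable: "integrable lborel \<phi>"
proof (rule integrableI_bounded_set[where A = "{-J..J}" and B = 1])
  show "AE x in lborel. x \<notin> {-J..J} \<longrightarrow> \<phi> x = 0" using support by auto
qed (use nonneg le_1 in \<open>auto simp: abs_of_nonneg emeasure_lborel_Icc_eq\<close>)

section \<open>Cut-off estimate from the weak formulation\<close>

lemma C21_strip_product:
  assumes "\<And>t. (\<eta> has_real_derivative \<eta>' t) (at t)" "continuous_on UNIV \<eta>'"
  shows "C21_strip 0 T (\<lambda>z. \<phi> (fst z) * \<eta> (snd z)) (\<lambda>z. \<phi>' (fst z) * \<eta> (snd z))
    (\<lambda>z. \<phi>'' (fst z) * \<eta> (snd z)) (\<lambda>z. \<phi> (fst z) * \<eta>' (snd z))"
proof -
  have "continuous_on UNIV \<eta>"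
    using assms(1) by (meson DERIV_isCont continuous_at_imp_continuous_on)
  note cont = continuous_on_compose2[OF this] continuous_on_compose2[OF assms(2)]
    continuous_on_compose2[OF continuous[of UNIV]] continuous_on_compose2[OF continuous'[of UNIV]]
    continuous_on_compose2[OF continuous'']
  show ?thesis
    unfolding C21_strip_def
    by (auto intro!: continuous_intros cont DERIV_cmult_right DERIV_cmult deriv deriv'
        has_field_derivative_at_within[OF assms(1)])
qed

lemma weak_estimate:
  fixes w g :: "real \<times> real \<Rightarrow> real" and a :: "real \<Rightarrow> real"
  assumes T: "0 < T" and d: "0 \<le> d" and M: "0 \<le> M"
    and w: "w \<in> borel_measurable (lebesgue_on (QT T))" and g: "g \<in> borel_measurable (lebesgue_on (QT T))"
    and w_bounds: "AE z in lebesgue_on (QT T). 0 \<le> w z \<and> w z \<le> M"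
    and g_bounds: "AE z in lebesgue_on (QT T). 0 \<le> g z \<and> g z \<le> G"
    and weak: "\<And>\<psi> \<psi>x \<psi>xx \<psi>t. C21_strip 0 T \<psi> \<psi>x \<psi>xx \<psi>t \<Longrightarrow> (\<forall>x. \<psi> (x, T) = 0) \<Longrightarrow>
        (\<exists>J>0. \<forall>x. \<forall>t\<in>{0..T}. \<psi> (x, t) \<noteq> 0 \<longrightarrow> x \<in> {-J..J}) \<Longrightarrow>
        (LINT z:QT T|lebesgue. w z * \<psi>t z) + (LINT z:QT T|lebesgue. d * w z * \<psi>xx z - g z * \<psi> z)
          = - (LINT x|lebesgue. a x * \<psi> (x, 0))"
  shows "(\<integral>\<^sup>+z. ennreal (g z * \<phi> (fst z)) \<partial>lebesgue_on (QT T))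
    \<le> ennreal (d * M * T * A + (LINT x|lebesgue. a x * \<phi> x))"
proof -
  define R where "R = lebesgue_on (QT T)"
  have LINT_R: "(LINT z:QT T|lebesgue. f z) = (LINT z|R. f z)" for f :: "real \<times> real \<Rightarrow> real"
    unfolding R_def by (simp add: set_lebesgue_integral_def integral_restrict_space)
  note [measurable] = w[folded R_def] g[folded R_def]
  note lift = borel_measurable_lebesgue_onI[where S = "QT T", folded R_def]
  have [measurable]: "fst \<in> borel_measurable R" "snd \<in> borel_measurable R"
    using lift[OF borel_measurable_continuous_onI[OF continuous_on_fst[OF continuous_on_id]]]
      lift[OF borel_measurable_continuous_onI[OF continuous_on_snd[OF continuous_on_id]]] by simp_all
  note w_R = w_bounds[folded R_def] and g_R = g_bounds[folded R_def]
  have QT_R: "AE z in R. 0 < snd z \<and> snd z < T"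
    by (rule AE_I2) (auto simp: R_def QT_def)
  \<comment> \<open>The exponent \<open>Suc n\<close> makes \<open>s n 0 = 0\<close> also for
    \<open>n = 0\<close>, so the test function starts exactly at \<open>\<phi>\<close>;
    \<open>s n T = 1\<close> makes it vanish at the final time.\<close>
  define s where "s n t = (t / T) ^ Suc n" for n t
  have s: "0 \<le> s n t" "s n t \<le> 1" if "0 < t" "t < T" for n t
    using that by (auto simp: s_def intro!: power_le_one simp del: power_Suc)
  have [measurable]: "(\<lambda>z. s n (snd z)) \<in> borel_measurable R" for n
    unfolding s_def by measurable
  note int = integral_QT_fst(1)[OF T integrable, folded R_def] integral_QT_fst(1)[OF T integrable'', folded R_def]
  have est: "(\<integral>\<^sup>+z. ennreal (g z * (\<phi> (fst z) * (1 - s n (snd z)))) \<partial>R)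
      \<le> ennreal (d * M * T * A + (LINT x|lebesgue. a x * \<phi> x))" for n
  proof -
    define s' where "s' t = real (Suc n) * (t / T) ^ n / T" for t
    define \<eta> where "\<eta> t = 1 - s n t" for t
    have \<eta>: "0 \<le> \<eta> t" "\<eta> t \<le> 1" if "0 < t" "t < T" for t
      using s[OF that] by (auto simp: \<eta>_def)
    have \<eta>_deriv: "(\<eta> has_real_derivative - s' t) (at t)" for t
      unfolding \<eta>_def[abs_def] s_def s'_def using T by (auto intro!: derivative_eq_intros simp del: power_Suc)
    have [measurable]: "(\<lambda>z. \<eta> (snd z)) \<in> borel_measurable R" "(\<lambda>z. s' (snd z)) \<in> borel_measurable R"
      unfolding \<eta>_def s'_def by measurable
    have "C21_strip 0 T (\<lambda>z. \<phi> (fst z) * \<eta> (snd z)) (\<lambda>z. \<phi>' (fst z) * \<eta> (snd z))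
        (\<lambda>z. \<phi>'' (fst z) * \<eta> (snd z)) (\<lambda>z. \<phi> (fst z) * - s' (snd z))"
      by (rule C21_strip_product[OF \<eta>_deriv]) (use T in \<open>auto simp: s'_def intro!: continuous_intros\<close>)
    from weak[OF this] have identity: "(LINT z|R. w z * (\<phi> (fst z) * - s' (snd z))) +
        (LINT z|R. d * w z * (\<phi>'' (fst z) * \<eta> (snd z)) - g z * (\<phi> (fst z) * \<eta> (snd z)))
          = - (LINT x|lebesgue. a x * \<phi> x)"
      unfolding LINT_R using T J_pos support by (force simp: \<eta>_def s_def)
    \<comment> \<open>This integral enters the identity with a minus sign, so discarding it only
      enlarges the bound on the reaction term.\<close>
    have sign: "0 \<le> (LINT z|R. w z * (\<phi> (fst z) * s' (snd z)))"
      using w_R QT_R T by (intro integral_nonneg_AE) (auto elim!: eventually_elim2 simp: s'_def nonneg)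
    \<comment> \<open>The integral of a difference splits only for integrable parts. The bound
      \<open>G\<close> serves this purpose and does not survive in the estimate.\<close>
    have int_g: "integrable R (\<lambda>z. g z * (\<phi> (fst z) * \<eta> (snd z)))"
    proof (rule Bochner_Integration.integrable_bound)
      show "integrable R (\<lambda>z. G * \<phi> (fst z))" using int by simp
      show "AE z in R. norm (g z * (\<phi> (fst z) * \<eta> (snd z))) \<le> norm (G * \<phi> (fst z))"
        using g_R QT_R
      proof eventually_elim
        case (elim z)
        then have "g z * (\<phi> (fst z) * \<eta> (snd z)) \<le> G * (\<phi> (fst z) * 1)"
          using \<eta>[of "snd z"] nonneg by (intro mult_mono) auto
        then show ?case using elim \<eta>[of "snd z"] nonneg by (simp add: abs_mult)
      qed
    qed measurable
    have bd_w: "AE z in R. \<bar>d * w z * (\<phi>'' (fst z) * \<eta> (snd z))\<bar> \<le> d * M * \<bar>\<phi>'' (fst z)\<bar>"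
      using w_R QT_R
    proof eventually_elim
      case (elim z)
      then have "d * w z * (\<bar>\<phi>'' (fst z)\<bar> * \<eta> (snd z)) \<le> d * M * (\<bar>\<phi>'' (fst z)\<bar> * 1)"
        using \<eta>[of "snd z"] d by (intro mult_mono) auto
      then show ?case using elim \<eta>[of "snd z"] d by (simp add: abs_mult)
    qed
    have int_w: "integrable R (\<lambda>z. d * w z * (\<phi>'' (fst z) * \<eta> (snd z)))"
    proof (rule Bochner_Integration.integrable_bound)
      show "integrable R (\<lambda>z. d * M * \<bar>\<phi>'' (fst z)\<bar>)" using int by simp
      show "AE z in R. norm (d * w z * (\<phi>'' (fst z) * \<eta> (snd z))) \<le> norm (d * M * \<bar>\<phi>'' (fst z)\<bar>)"
        using bd_w d M by simp
    qed measurable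
    have "(LINT z|R. d * w z * (\<phi>'' (fst z) * \<eta> (snd z))) \<le> (LINT z|R. d * M * \<bar>\<phi>'' (fst z)\<bar>)"
      using bd_w int int_w by (intro integral_mono_AE) auto
    also have "(LINT z|R. d * M * \<bar>\<phi>'' (fst z)\<bar>) = d * M * (T * (LINT x|lborel. \<bar>\<phi>'' x\<bar>))"
      using integral_QT_fst(2)[OF T integrable''] by (simp add: R_def)
    also have "\<dots> \<le> d * M * (T * A)"
      using integral_abs'' d M T by (intro mult_left_mono) auto
    finally have "(LINT z|R. g z * (\<phi> (fst z) * \<eta> (snd z))) \<le> d * M * T * A + (LINT x|lebesgue. a x * \<phi> x)"
      using identity sign unfolding Bochner_Integration.integral_diff[OF int_w int_g] by (simp add: mult.assoc)
    moreover have "(\<integral>\<^sup>+z. ennreal (g z * (\<phi> (fst z) * \<eta> (snd z))) \<partial>R) = ennreal (LINT z|R. g z * (\<phi> (fst z) * \<eta> (snd z)))"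
      using int_g by (rule nn_integral_eq_integral)
        (use g_R QT_R \<eta> nonneg in \<open>auto elim!: eventually_elim2\<close>)
    ultimately show ?thesis by (simp add: \<eta>_def ennreal_leI)
  qed
  have "(\<integral>\<^sup>+z. ennreal (g z * \<phi> (fst z)) \<partial>R) \<le> ennreal (d * M * T * A + (LINT x|lebesgue. a x * \<phi> x))"
  proof (rule nn_integral_le_limit[OF _ _ est tendsto_const])
    fix z assume "z \<in> space R"
    then have "0 < snd z" "snd z < T" by (auto simp: R_def QT_def)
    then have "(\<lambda>n. s n (snd z)) \<longlonglongrightarrow> 0"
      unfolding s_def by (intro LIMSEQ_Suc LIMSEQ_realpow_zero) auto
    then have "(\<lambda>n. ennreal (g z * (\<phi> (fst z) * (1 - s n (snd z))))) \<longlonglongrightarrow> ennreal (g z * (\<phi> (fst z) * (1 - 0)))"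
      by (intro tendsto_intros)
    then show "ennreal (g z * \<phi> (fst z)) \<le> liminf (\<lambda>n. ennreal (g z * (\<phi> (fst z) * (1 - s n (snd z)))))"
      by (simp add: lim_imp_Liminf)
  qed measurable
  then show ?thesis by (simp add: R_def)
qed

section \<open>Cut-off estimate for classical solutions\<close>

lemma integral_interval_abs'': "integral {-J..J} (\<lambda>x. \<bar>\<phi>'' x\<bar>) \<le> A"
proof -
  have "ennreal (integral {-J..J} (\<lambda>x. \<bar>\<phi>'' x\<bar>)) = (\<integral>\<^sup>+x\<in>{-J..J}. ennreal \<bar>\<phi>'' x\<bar> \<partial>lborel)"
    by (rule nn_integral_has_integral_lebesgue'[symmetric])
      (auto intro!: integrable_integral integrable_continuous_interval continuous_intros continuous''_on)
  also have "\<dots> \<le> (\<integral>\<^sup>+x. ennreal \<bar>\<phi>'' x\<bar> \<partial>lborel)"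
    by (intro nn_integral_mono) (auto simp: indicator_def)
  also note variation
  finally show ?thesis using A_nonneg by simp
qed

text \<open>Lagrange's identity: \<open>f' \<phi> - f \<phi>'\<close> is an antiderivative of
  \<open>f'' \<phi> - f \<phi>''\<close>. At the endpoints \<open>f\<close> and \<open>f'\<close>
  are multiplied by zero, so their size there is irrelevant.\<close>

lemma integral_by_parts_twice:
  assumes "\<And>x. (f has_real_derivative f' x) (at x)" "\<And>x. (f' has_real_derivative f'' x) (at x)"
    and "continuous_on UNIV f''"
  shows "integral {-J..J} (\<lambda>x. f'' x * \<phi> x) = integral {-J..J} (\<lambda>x. f x * \<phi>'' x)"
proof -
  have cont: "continuous_on {-J..J} f" "continuous_on {-J..J} f''"
    using assms by (meson DERIV_isCont continuous_at_imp_continuous_on continuous_on_subset top_greatest)+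
  have "((\<lambda>x. f' x * \<phi> x - f x * \<phi>' x) has_real_derivative (f'' x * \<phi> x - f x * \<phi>'' x)) (at x)" for x
    by (rule derivative_eq_intros assms(1,2) deriv deriv' refl)+ simp
  then have "((\<lambda>x. f'' x * \<phi> x - f x * \<phi>'' x) has_integral
      (f' J * \<phi> J - f J * \<phi>' J) - (f' (-J) * \<phi> (-J) - f (-J) * \<phi>' (-J))) {-J..J}"
    using J_pos by (intro fundamental_theorem_of_calculus)
      (auto simp: has_real_derivative_iff_has_vector_derivative intro: has_vector_derivative_at_within)
  then have "((\<lambda>x. f'' x * \<phi> x - f x * \<phi>'' x) has_integral 0) {-J..J}"
    using support[of J] support[of "-J"] J_pos by simp
  moreover have "((\<lambda>x. f'' x * \<phi> x - f x * \<phi>'' x) has_integral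
      integral {-J..J} (\<lambda>x. f'' x * \<phi> x) - integral {-J..J} (\<lambda>x. f x * \<phi>'' x)) {-J..J}"
    by (intro has_integral_diff integrable_integral integrable_continuous_interval continuous_intros
        cont continuous continuous''_on)
  ultimately have "0 = integral {-J..J} (\<lambda>x. f'' x * \<phi> x) - integral {-J..J} (\<lambda>x. f x * \<phi>'' x)"
    by (rule has_integral_unique)
  then show ?thesis by simp
qed

text \<open>All derivatives involved are continuous on the closed box, so either variable can be
  integrated first: \<open>x\<close> for the diffusion term, to move two derivatives onto
  \<open>\<phi>\<close>, and \<open>t\<close> for the time derivative, to produce the masses at
  \<open>t0\<close> and \<open>t1\<close>.\<close>

lemma classical_box_estimate:
  fixes w g wx wxx wt :: "real \<times> real \<Rightarrow> real"
  assumes t01: "0 \<le> t0" "t0 \<le> t1" and d: "0 \<le> d" and M: "0 \<le> M"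
    and C21: "C21_strip t0 t1 w wx wxx wt"
    and eq: "\<And>x t. t0 \<le> t \<Longrightarrow> t \<le> t1 \<Longrightarrow> wt (x, t) = d * wxx (x, t) - g (x, t)"
    and w: "\<And>x t. t0 \<le> t \<Longrightarrow> t \<le> t1 \<Longrightarrow> 0 \<le> w (x, t) \<and> w (x, t) \<le> M"
    and g: "\<And>x t. t0 \<le> t \<Longrightarrow> t \<le> t1 \<Longrightarrow> 0 \<le> g (x, t)"
  shows "(\<integral>\<^sup>+z. ennreal (g z * \<phi> (fst z)) * indicator ({-J..J} \<times> {t0..t1}) z \<partial>lborel)
    \<le> ennreal (d * M * (t1 - t0) * A + integral {-J..J} (\<lambda>x. w (x, t0) * \<phi> x))"
proof -
  define B where "B = cbox (-J, t0) (J, t1)"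
  have B: "B = {-J..J} \<times> {t0..t1}" by (auto simp: B_def)
  have sub: "B \<subseteq> UNIV \<times> {t0..t1}" by (auto simp: B)
  from C21 have dx: "\<And>x t. t \<in> {t0..t1} \<Longrightarrow> ((\<lambda>y. w (y, t)) has_real_derivative wx (x, t)) (at x)"
    and dxx: "\<And>x t. t \<in> {t0..t1} \<Longrightarrow> ((\<lambda>y. wx (y, t)) has_real_derivative wxx (x, t)) (at x)"
    and dt: "\<And>x t. t \<in> {t0..t1} \<Longrightarrow> ((\<lambda>s. w (x, s)) has_real_derivative wt (x, t)) (at t within {t0..t1})"
    and cw: "continuous_on (UNIV \<times> {t0..t1}) w"
    and cxx: "continuous_on (UNIV \<times> {t0..t1}) wxx" and ct: "continuous_on (UNIV \<times> {t0..t1}) wt"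
    unfolding C21_strip_def by blast+
  have slice_x: "continuous_on S (\<lambda>x. f (x, t))" if "continuous_on (UNIV \<times> {t0..t1}) f" "t \<in> {t0..t1}"
    for f :: "real \<times> real \<Rightarrow> real" and S t
    using that by (intro continuous_on_compose2[OF that(1)] continuous_intros) auto
  have cphi: "continuous_on S (\<lambda>z. \<phi> (fst z))" for S :: "(real \<times> real) set"
    by (rule continuous_on_compose2[OF continuous[of UNIV]]) (auto intro: continuous_intros)
  have c1: "continuous_on B (\<lambda>z. wxx z * \<phi> (fst z))" and c2: "continuous_on B (\<lambda>z. wt z * \<phi> (fst z))"
    using continuous_on_subset[OF cxx sub] continuous_on_subset[OF ct sub]
    by (auto intro!: continuous_intros cphi)
  have cg: "continuous_on B (\<lambda>z. d * (wxx z * \<phi> (fst z)) - wt z * \<phi> (fst z))"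
    by (intro continuous_intros c1 c2)
  have I1: "integral B (\<lambda>z. wxx z * \<phi> (fst z)) \<le> M * (t1 - t0) * A"
  proof -
    have "integral B (\<lambda>z. wxx z * \<phi> (fst z)) =
        integral {-J..J} (\<lambda>x. integral {t0..t1} (\<lambda>t. wxx (x, t) * \<phi> x))"
      using integral_prod_continuous[OF c1[unfolded B_def]] by (simp add: B_def)
    also have "\<dots> = integral {t0..t1} (\<lambda>t. integral {-J..J} (\<lambda>x. wxx (x, t) * \<phi> x))"
      using integral_swap_continuous[of "-J" t0 J t1 "\<lambda>x t. wxx (x, t) * \<phi> x"] c1
      by (simp add: B_def case_prod_unfold)
    also have "\<dots> = integral {t0..t1} (\<lambda>t. integral {-J..J} (\<lambda>x. w (x, t) * \<phi>'' x))"
      using dx dxx slice_x[OF cxx] by (intro integral_cong integral_by_parts_twice) auto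
    also have "\<dots> \<le> integral {t0..t1} (\<lambda>t. M * A)"
    proof (rule integral_le)
      have "continuous_on ({t0..t1} \<times> cbox (-J) J) (\<lambda>(t, x). w (x, t) * \<phi>'' x)"
        unfolding case_prod_unfold
        by (intro continuous_intros continuous_on_compose2[OF cw] continuous_on_compose2[OF continuous'']) auto
      then show "(\<lambda>t. integral {-J..J} (\<lambda>x. w (x, t) * \<phi>'' x)) integrable_on {t0..t1}"
        using integral_continuous_on_param[of "{t0..t1}" "-J" J "\<lambda>t x. w (x, t) * \<phi>'' x"]
        by (auto intro: integrable_continuous_interval)
    next
      fix t assume t: "t \<in> {t0..t1}"
      have "integral {-J..J} (\<lambda>x. w (x, t) * \<phi>'' x) \<le> integral {-J..J} (\<lambda>x. M * \<bar>\<phi>'' x\<bar>)"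
      proof (rule integral_le)
        fix x
        have "w (x, t) * \<phi>'' x \<le> w (x, t) * \<bar>\<phi>'' x\<bar>" using w[of t x] t by (intro mult_left_mono) auto
        also have "\<dots> \<le> M * \<bar>\<phi>'' x\<bar>" using w[of t x] t by (intro mult_right_mono) auto
        finally show "w (x, t) * \<phi>'' x \<le> M * \<bar>\<phi>'' x\<bar>" .
      qed (auto intro!: integrable_continuous_interval continuous_intros continuous''_on slice_x[OF cw] t)
      also have "\<dots> = M * integral {-J..J} (\<lambda>x. \<bar>\<phi>'' x\<bar>)" by simp
      also have "\<dots> \<le> M * A" using M integral_interval_abs'' by (intro mult_left_mono)
      finally show "integral {-J..J} (\<lambda>x. w (x, t) * \<phi>'' x) \<le> M * A" .
    qed auto
    also have "\<dots> = M * (t1 - t0) * A" using t01 by simp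
    finally show ?thesis .
  qed
  have I2: "integral B (\<lambda>z. wt z * \<phi> (fst z)) \<ge> - integral {-J..J} (\<lambda>x. w (x, t0) * \<phi> x)"
  proof -
    have "- integral {-J..J} (\<lambda>x. w (x, t0) * \<phi> x) = integral {-J..J} (\<lambda>x. - (w (x, t0) * \<phi> x))"
      by simp
    \<comment> \<open>The mass at the final time \<open>t1\<close> is nonnegative and is given away
      here.\<close>
    also have "\<dots> \<le> integral {-J..J} (\<lambda>x. w (x, t1) * \<phi> x - w (x, t0) * \<phi> x)"
      using t01 w[of t1] nonneg
      by (intro integral_le integrable_continuous_interval continuous_intros slice_x[OF cw] continuous) auto
    also have "\<dots> = integral {-J..J} (\<lambda>x. integral {t0..t1} (\<lambda>t. wt (x, t) * \<phi> x))"
    proof (rule integral_cong)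
      fix x
      have "((\<lambda>t. wt (x, t)) has_integral w (x, t1) - w (x, t0)) {t0..t1}"
        using t01 dt by (intro fundamental_theorem_of_calculus)
          (auto simp: has_real_derivative_iff_has_vector_derivative[symmetric])
      then have "((\<lambda>t. wt (x, t) * \<phi> x) has_integral (w (x, t1) - w (x, t0)) * \<phi> x) {t0..t1}"
        by (rule has_integral_mult_left)
      then show "w (x, t1) * \<phi> x - w (x, t0) * \<phi> x = integral {t0..t1} (\<lambda>t. wt (x, t) * \<phi> x)"
        by (metis integral_unique left_diff_distrib)
    qed
    also have "\<dots> = integral B (\<lambda>z. wt z * \<phi> (fst z))"
      using integral_prod_continuous[OF c2[unfolded B_def]] by (simp add: B_def)
    finally show ?thesis .
  qed
  \<comment> \<open>Through the equation the weighted reaction term equals a continuous function on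
    the box, so its Lebesgue integral is a gauge integral that can be split.\<close>
  have g_eq: "g z * \<phi> (fst z) = d * (wxx z * \<phi> (fst z)) - wt z * \<phi> (fst z)" if "z \<in> B" for z
  proof -
    have "wt z = d * wxx z - g z" using eq[of "snd z" "fst z"] that by (auto simp: B)
    then have "g z = d * wxx z - wt z" by simp
    then show ?thesis by (simp only: left_diff_distrib mult.assoc)
  qed
  have "integral B (\<lambda>z. d * (wxx z * \<phi> (fst z)) - wt z * \<phi> (fst z))
      = d * integral B (\<lambda>z. wxx z * \<phi> (fst z)) - integral B (\<lambda>z. wt z * \<phi> (fst z))"
    using c1 c2 unfolding B_def
    by (subst integral_diff) (auto intro!: integrable_continuous continuous_intros)
  also have "\<dots> \<le> d * (M * (t1 - t0) * A) + integral {-J..J} (\<lambda>x. w (x, t0) * \<phi> x)"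
    using mult_left_mono[OF I1 d] I2 by linarith
  finally have le: "integral B (\<lambda>z. d * (wxx z * \<phi> (fst z)) - wt z * \<phi> (fst z))
      \<le> d * M * (t1 - t0) * A + integral {-J..J} (\<lambda>x. w (x, t0) * \<phi> x)" by (simp add: mult.assoc)
  have "(\<integral>\<^sup>+z. ennreal (g z * \<phi> (fst z)) * indicator B z \<partial>lborel)
      = (\<integral>\<^sup>+z. ennreal (d * (wxx z * \<phi> (fst z)) - wt z * \<phi> (fst z)) * indicator B z \<partial>lborel)"
    using g_eq by (intro nn_integral_cong) (auto simp: indicator_def)
  also have "\<dots> = ennreal (integral B (\<lambda>z. d * (wxx z * \<phi> (fst z)) - wt z * \<phi> (fst z)))"
  proof (rule nn_integral_has_integral_lebesgue')
    show "0 \<le> d * (wxx z * \<phi> (fst z)) - wt z * \<phi> (fst z)" if "z \<in> B" for z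
    proof -
      have "0 \<le> g z" using g[of "snd z" "fst z"] that by (auto simp: B)
      then show ?thesis unfolding g_eq[OF that, symmetric] using nonneg by simp
    qed
    show "((\<lambda>z. d * (wxx z * \<phi> (fst z)) - wt z * \<phi> (fst z)) has_integral
        integral B (\<lambda>z. d * (wxx z * \<phi> (fst z)) - wt z * \<phi> (fst z))) B"
      using cg unfolding B_def by (intro integrable_integral integrable_continuous)
  qed
  also have "\<dots> \<le> ennreal (d * M * (t1 - t0) * A + integral {-J..J} (\<lambda>x. w (x, t0) * \<phi> x))"
    using le by (rule ennreal_leI)
  finally show ?thesis by (simp add: B)
qed

text \<open>The derivatives are controlled only for times bounded away from 0 and the equation holds
  only before \<open>T\<close>, so boxes over \<open>[\<delta> n, T - \<delta> n]\<close> exhaust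
  the strip and Fatou's lemma gives the limit.\<close>

lemma classical_estimate:
  fixes w g wx wxx wt :: "real \<times> real \<Rightarrow> real"
  assumes T: "0 < T" and d: "0 \<le> d" and M: "0 \<le> M"
    and C21: "\<And>\<delta>. 0 < \<delta> \<Longrightarrow> \<delta> < T \<Longrightarrow> C21_strip \<delta> T w wx wxx wt"
    and eq: "\<And>z. z \<in> QT T \<Longrightarrow> wt z = d * wxx z - g z"
    and cont: "continuous_on (UNIV \<times> {0..T}) w" and init: "\<And>x. w (x, 0) = a x"
    and w: "\<And>z. z \<in> QT T \<Longrightarrow> 0 \<le> w z \<and> w z \<le> M"
    and g: "\<And>z. z \<in> QT T \<Longrightarrow> 0 \<le> g z" and g_meas: "g \<in> borel_measurable (lebesgue_on (QT T))"
  shows "(\<integral>\<^sup>+z. ennreal (g z * \<phi> (fst z)) \<partial>lebesgue_on (QT T))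
    \<le> ennreal (d * M * T * A + (LINT x|lebesgue. a x * \<phi> x))"
proof -
  \<comment> \<open>The shift by 3 keeps \<open>\<delta> n\<close> at most \<open>T / 3\<close>, so
    every box is a genuine one, from \<open>n = 0\<close> on.\<close>
  define \<delta> where "\<delta> n = T / (real n + 3)" for n :: nat
  define box where "box n = {-J..J} \<times> {\<delta> n..T - \<delta> n}" for n
  have \<delta>: "0 < \<delta> n" "\<delta> n \<le> T - \<delta> n" "T - \<delta> n < T" for n
    using T by (auto simp: \<delta>_def field_simps)
  have \<delta>_lim: "\<delta> \<longlonglongrightarrow> 0" unfolding \<delta>_def using LIMSEQ_ignore_initial_segment[OF lim_const_over_n[of T], of 3]
    by (simp add: add.commute)
  have box_meas: "box n \<in> sets borel" for n
    unfolding box_def by (intro borel_closed closed_Times) auto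
  have phi_meas: "(\<lambda>z::real \<times> real. \<phi> (fst z)) \<in> borel_measurable borel"
    by (intro borel_measurable_continuous_onI continuous_on_compose2[OF continuous[of UNIV]] continuous_intros) auto
  have est: "(\<integral>\<^sup>+z. ennreal (g z * \<phi> (fst z)) * indicator (box n) z \<partial>lebesgue_on (QT T))
      \<le> ennreal (d * M * T * A + integral {-J..J} (\<lambda>x. w (x, \<delta> n) * \<phi> x))" for n
  proof -
    have sub: "(x, t) \<in> QT T" if "\<delta> n \<le> t" "t \<le> T - \<delta> n" for x t
      using \<delta>[of n] that by (auto simp: QT_def)
    from C21[of "\<delta> n"] \<delta>[of n] have C: "C21_strip (\<delta> n) T w wx wxx wt" by auto
    then have C': "C21_strip (\<delta> n) (T - \<delta> n) w wx wxx wt"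
      by (rule C21_strip_subinterval) (use \<delta>[of n] in auto)
    have "(\<integral>\<^sup>+z. ennreal (g z * \<phi> (fst z)) * indicator (box n) z \<partial>lborel)
      \<le> ennreal (d * M * (T - \<delta> n - \<delta> n) * A + integral {-J..J} (\<lambda>x. w (x, \<delta> n) * \<phi> x))"
      unfolding box_def
      by (rule classical_box_estimate[OF _ _ d M C'])
        (use \<delta>[of n] eq w g sub in auto)
    also have "\<dots> \<le> ennreal (d * M * T * A + integral {-J..J} (\<lambda>x. w (x, \<delta> n) * \<phi> x))"
      using d M \<delta>[of n] A_nonneg by (intro ennreal_leI add_right_mono mult_right_mono mult_left_mono) auto
    finally have "(\<integral>\<^sup>+z. ennreal (g z * \<phi> (fst z)) * indicator (box n) z \<partial>lebesgue) \<le> \<dots>"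
      by (simp add: nn_integral_completion)
    moreover have "(\<integral>\<^sup>+z. ennreal (g z * \<phi> (fst z)) * indicator (box n) z \<partial>lebesgue_on (QT T))
        \<le> (\<integral>\<^sup>+z. ennreal (g z * \<phi> (fst z)) * indicator (box n) z \<partial>lebesgue)"
      using QT_sets(2) by (simp add: nn_integral_restrict_space) (intro nn_integral_mono, auto simp: indicator_def)
    ultimately show ?thesis by (rule order_trans[rotated])
  qed
  \<comment> \<open>Continuity of \<open>w\<close> down to \<open>t = 0\<close> makes the mass at
    time \<open>\<delta> n\<close> converge to the initial one.\<close>
  have "continuous_on ({0..T} \<times> cbox (-J) J) (\<lambda>(t, x). w (x, t) * \<phi> x)"
    unfolding case_prod_unfold
    by (intro continuous_intros continuous_on_compose2[OF cont] continuous_on_compose2[OF continuous[of UNIV]]) auto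
  then have "continuous_on {0..T} (\<lambda>t. integral (cbox (-J) J) (\<lambda>x. w (x, t) * \<phi> x))"
    by (rule integral_continuous_on_param)
  then have "((\<lambda>n. integral (cbox (-J) J) (\<lambda>x. w (x, \<delta> n) * \<phi> x)) \<longlonglongrightarrow> integral (cbox (-J) J) (\<lambda>x. w (x, 0) * \<phi> x))"
  proof (rule continuous_on_tendsto_compose[OF _ \<delta>_lim])
    have "\<delta> n \<in> {0..T}" for n using \<delta>[of n] by simp
    then show "\<forall>\<^sub>F n in sequentially. \<delta> n \<in> {0..T}" by simp
  qed (use T in simp)
  then have lim: "(\<lambda>n. integral {-J..J} (\<lambda>x. w (x, \<delta> n) * \<phi> x)) \<longlonglongrightarrow> integral {-J..J} (\<lambda>x. a x * \<phi> x)"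
    by (simp add: init)
  have "integral {-J..J} (\<lambda>x. a x * \<phi> x) = (LINT x|lebesgue. a x * \<phi> x)"
  proof -
    have "continuous_on {-J..J} (\<lambda>x. w (x, 0) * \<phi> x)"
      using T by (intro continuous_intros continuous_on_compose2[OF cont] continuous) auto
    then have "set_integrable lborel {-J..J} (\<lambda>x. a x * \<phi> x)"
      unfolding init by (rule borel_integrable_atLeastAtMost')
    then have "(LINT x:{-J..J}|lborel. a x * \<phi> x) = integral {-J..J} (\<lambda>x. a x * \<phi> x)"
      "set_borel_measurable lborel {-J..J} (\<lambda>x. a x * \<phi> x)"
      by (auto simp: set_borel_integral_eq_integral set_integrable_def set_borel_measurable_def)
    moreover have "(\<lambda>x. indicator {-J..J} x *\<^sub>R (a x * \<phi> x)) = (\<lambda>x. a x * \<phi> x)"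
      using support by (auto simp: indicator_def fun_eq_iff abs_le_iff not_le intro!: support)
    ultimately show ?thesis
      by (simp add: set_lebesgue_integral_def set_borel_measurable_def integral_completion)
  qed
  note lim = lim[unfolded this]
  show ?thesis
  proof (rule nn_integral_le_limit[OF _ _ est])
    show "(\<lambda>z. ennreal (g z * \<phi> (fst z)) * indicator (box n) z) \<in> borel_measurable (lebesgue_on (QT T))" for n
      using box_meas
      by (intro borel_measurable_times_ennreal borel_measurable_times measurable_compose[OF _ measurable_ennreal] g_meas
          borel_measurable_lebesgue_onI phi_meas borel_measurable_indicator) auto
    show "(\<lambda>n. ennreal (d * M * T * A + integral {-J..J} (\<lambda>x. w (x, \<delta> n) * \<phi> x)))
        \<longlonglongrightarrow> ennreal (d * M * T * A + (LINT x|lebesgue. a x * \<phi> x))"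
      by (intro tendsto_intros lim)
    fix z assume "z \<in> space (lebesgue_on (QT T))"
    then have z: "0 < snd z" "snd z < T" by (auto simp: QT_def)
    show "ennreal (g z * \<phi> (fst z)) \<le> liminf (\<lambda>n. ennreal (g z * \<phi> (fst z)) * indicator (box n) z)"
    proof (cases "\<bar>fst z\<bar> \<le> J")
      case True
      have "\<forall>\<^sub>F n in sequentially. \<delta> n < min (snd z) (T - snd z)"
        using z by (intro order_tendstoD[OF \<delta>_lim]) auto
      then have "\<forall>\<^sub>F n in sequentially. ennreal (g z * \<phi> (fst z)) \<le> ennreal (g z * \<phi> (fst z)) * indicator (box n) z"
        by eventually_elim (use True in \<open>auto simp: box_def mem_Times_iff indicator_def\<close>)
      then show ?thesis by (rule Liminf_bounded)
    qed (use support in simp)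
  qed
qed

text \<open>Split \<open>a\<close> into \<open>a - a_inf\<close> and \<open>a_inf\<close>. As \<phi>
  lies between 0 and 1, the first part costs an \<open>L^1\<close> distance; the second meets the
  cut-off only on one ramp, which has length 1.\<close>

lemma initial_estimate:
  assumes int: "integrable lebesgue (\<lambda>x. a x - a_inf x)" and "0 \<le> W"
    and bd: "\<And>x. a_inf x * \<phi> x \<le> W * indicator {c..c+1} x"
  shows "(LINT x|lebesgue. a x * \<phi> x) \<le> L1_norm (\<lambda>x. a x - a_inf x) + W"
proof -
  have int_ind: "integrable lebesgue (\<lambda>x. W * indicator {c..c+1} x)"
    by (intro integrable_mult_right) (auto simp: emeasure_lborel_Icc_eq)
  have "(LINT x|lebesgue. a x * \<phi> x) \<le> (LINT x|lebesgue. \<bar>a x - a_inf x\<bar> + W * indicator {c..c+1} x)"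
  proof (rule integral_mono')
    show "integrable lebesgue (\<lambda>x. \<bar>a x - a_inf x\<bar> + W * indicator {c..c+1} x)"
      using int int_ind by simp
    fix x
    have "a x * \<phi> x = (a x - a_inf x) * \<phi> x + a_inf x * \<phi> x" by (simp add: algebra_simps)
    also have "(a x - a_inf x) * \<phi> x \<le> \<bar>a x - a_inf x\<bar> * 1"
      using nonneg[of x] le_1[of x] by (intro mult_mono) auto
    finally show "a x * \<phi> x \<le> \<bar>a x - a_inf x\<bar> + W * indicator {c..c+1} x"
      using bd[of x] by simp
    show "0 \<le> \<bar>a x - a_inf x\<bar> + W * indicator {c..c+1} x" using assms(2) by simp
  qed
  also have "\<dots> = L1_norm (\<lambda>x. a x - a_inf x) + W"
    using int int_ind by (simp add: L1_norm_def)
  finally show ?thesis .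
qed

end

lemma cutoff_plateau:
  assumes "a \<le> b" "0 < J" "-J \<le> a" "b + 1 \<le> J"
  shows "cutoff J 120 (plateau a b) (plateau' a b) (plateau'' a b)"
proof
  fix x assume "J \<le> \<bar>x\<bar>"
  then have "x \<le> a \<or> b + 1 \<le> x" using assms by auto
  then show "plateau a b x = 0" "plateau' a b x = 0" "plateau'' a b x = 0"
    using assms by (auto simp: plateau_eq_0 plateau'_def plateau''_def smoothstep'_0 smoothstep''_0)
qed (use assms plateau_deriv plateau'_deriv plateau''_continuous plateau_bounds nn_integral_abs_plateau'' in auto)

section \<open>Solutions of the system\<close>

text \<open>The function spaces are local in \<open>x\<close>. Extensions by zero from growing
  rectangles are eventually constant at each point, so they converge to the extension from the
  strip.\<close>

lemma borel_measurable_lebesgue_on_QT: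
  fixes f :: "real \<times> real \<Rightarrow> real"
  assumes "\<And>J. J > 0 \<Longrightarrow> f \<in> borel_measurable (lebesgue_on ({-J<..<J} \<times> {0<..<T}))"
  shows "f \<in> borel_measurable (lebesgue_on (QT T))"
proof -
  define Q where "Q n = {- real (Suc n)<..<real (Suc n)} \<times> {0<..<T}" for n
  have Q: "Q n \<in> sets lebesgue" for n
  proof -
    have "open (Q n)" unfolding Q_def by (intro open_Times) auto
    then show ?thesis by auto
  qed
  have "(\<lambda>z. if z \<in> QT T then f z else 0) \<in> borel_measurable lebesgue"
  proof (rule borel_measurable_LIMSEQ_real)
    show "(\<lambda>z. if z \<in> Q n then f z else 0) \<in> borel_measurable lebesgue" for n
      using assms[of "real (Suc n)"] Q by (simp add: borel_measurable_if Q_def)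
    fix z :: "real \<times> real"
    have "\<forall>\<^sub>F n in sequentially. \<bar>fst z\<bar> < real (Suc n)"
      using eventually_gt_at_top[of "nat \<lceil>\<bar>fst z\<bar>\<rceil>"] by eventually_elim linarith
    then have "\<forall>\<^sub>F n in sequentially. (if z \<in> Q n then f z else 0) = (if z \<in> QT T then f z else 0)"
      by eventually_elim (auto simp: Q_def QT_def mem_Times_iff)
    then show "(\<lambda>n. if z \<in> Q n then f z else 0) \<longlonglongrightarrow> (if z \<in> QT T then f z else 0)"
      by (rule tendsto_eventually)
  qed
  then show ?thesis using QT_sets by (simp add: borel_measurable_if)
qed

text \<open>The exceptional set is open and null, hence empty. The classical argument evaluates
  solutions on single time slices, where bounds that hold almost everywhere would say
  nothing.\<close>

lemma continuous_on_AE_closed: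
  fixes f :: "'a::euclidean_space \<Rightarrow> 'b::topological_space"
  assumes S: "open S" and f: "continuous_on S f" and K: "closed K"
    and ae: "AE z in lebesgue_on S. f z \<in> K" and z: "z \<in> S"
  shows "f z \<in> K"
proof (rule ccontr)
  assume "f z \<notin> K"
  define V where "V = S \<inter> f -` (- K)"
  have "open V" unfolding V_def using S f K by (intro continuous_open_preimage) auto
  moreover have "z \<in> V" using z \<open>f z \<notin> K\<close> by (simp add: V_def)
  ultimately have "\<not> negligible V" using open_not_negligible by blast
  moreover have "AE z in lebesgue. z \<notin> V"
    using ae S by (subst (asm) AE_restrict_space_iff) (auto simp: V_def elim!: eventually_mono)
  then have "negligible V"
    using \<open>open V\<close> by (simp add: negligible_iff_null_sets AE_iff_null_sets)
  ultimately show False by contradiction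
qed

lemma solution_measurable:
  assumes sol: "solution T du dv k F a b u v"
  shows "u \<in> borel_measurable (lebesgue_on (QT T))" "v \<in> borel_measurable (lebesgue_on (QT T))"
proof -
  have "w \<in> borel_measurable (lebesgue_on (QT T))"
    if "\<forall>J>0. \<forall>p\<ge>1. in_W21p p ({-J<..<J} \<times> {0<..<T}) w" for w
    using that by (intro borel_measurable_lebesgue_on_QT) (force simp: in_W21p_def in_Lp_def)
  moreover have "w \<in> borel_measurable (lebesgue_on (QT T))"
    if "\<forall>J>0. in_W1inf_Linf T {-J<..<J} w" for w
    using that by (intro borel_measurable_lebesgue_on_QT) (simp add: in_W1inf_Linf_def in_Linf_Linf_def)
  moreover have "\<forall>J>0. \<forall>p\<ge>1. in_W21p p ({-J<..<J} \<times> {0<..<T}) u"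
    using sol unfolding solution_def classical_solution_def weak_solution_def
    by (elim disjE conjE) simp_all
  moreover have "(\<forall>J>0. \<forall>p\<ge>1. in_W21p p ({-J<..<J} \<times> {0<..<T}) v) \<or> (\<forall>J>0. in_W1inf_Linf T {-J<..<J} v)"
    using sol unfolding solution_def classical_solution_def weak_solution_def
    by (elim disjE conjE) (simp, erule disjI2)
  ultimately show "u \<in> borel_measurable (lebesgue_on (QT T))" "v \<in> borel_measurable (lebesgue_on (QT T))"
    by blast+
qed

lemma (in cutoff) solution_estimate:
  assumes T: "0 < T" and M: "0 < M" and du: "0 \<le> du" and k: "0 < k" and F: "admissible_F F"
    and sol: "solution T du dv k F a b u v"
    and bounds: "AE z in lebesgue_on (QT T). 0 \<le> u z \<and> u z \<le> M \<and> 0 \<le> v z \<and> v z \<le> M"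
  shows "(\<integral>\<^sup>+z. ennreal (k * F (u z) (v z) * \<phi> (fst z)) \<partial>lebesgue_on (QT T))
      \<le> ennreal (du * M * T * A + (LINT x|lebesgue. a x * \<phi> x))" (is "?I \<le> ?U")
    and "(\<integral>\<^sup>+z. ennreal (k * F (u z) (v z) * \<phi> (fst z)) \<partial>lebesgue_on (QT T))
      \<le> ennreal (dv * M * T * A + (LINT x|lebesgue. b x * \<phi> x))" (is "?I \<le> ?V")
proof -
  define g where "g z = k * F (u z) (v z)" for z
  note meas = solution_measurable[OF sol]
  have g_meas: "g \<in> borel_measurable (lebesgue_on (QT T))"
    unfolding g_def[abs_def] by (intro borel_measurable_times borel_measurable_const
        admissible_F_measurable[OF F M meas QT_sets(2) bounds])
  have g_nonneg: "0 \<le> g z" and g_le: "g z \<le> k * F M M" if "u z \<in> {0..M}" "v z \<in> {0..M}" for z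
    using admissible_F_bounds[OF F that] k by (simp_all add: g_def)
  from sol consider (classical) "0 < dv" "classical_solution T du dv k F a b u v"
    | (weak) "dv = 0" "weak_solution T du k F a b u v"
    unfolding solution_def by blast
  then have "?I \<le> ?U \<and> ?I \<le> ?V"
  proof cases
    case classical
    from classical(2) obtain ux uxx ut vx vxx vt where
      C21: "\<And>\<delta>. 0 < \<delta> \<Longrightarrow> \<delta> < T \<Longrightarrow> C21_strip \<delta> T u ux uxx ut"
        "\<And>\<delta>. 0 < \<delta> \<Longrightarrow> \<delta> < T \<Longrightarrow> C21_strip \<delta> T v vx vxx vt"
      and eq: "\<And>z. z \<in> QT T \<Longrightarrow> ut z = du * uxx z - g z" "\<And>z. z \<in> QT T \<Longrightarrow> vt z = dv * vxx z - g z"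
      unfolding classical_solution_def g_def by blast
    from classical(2) have cont: "continuous_on (UNIV \<times> {0..T}) u" "continuous_on (UNIV \<times> {0..T}) v"
      and init: "\<And>x. u (x, 0) = a x" "\<And>x. v (x, 0) = b x"
      unfolding classical_solution_def by blast+
    have QT: "open (QT T)" "QT T \<subseteq> UNIV \<times> {0..T}"
      by (auto simp: QT_def intro!: open_Times)
    have "AE z in lebesgue_on (QT T). u z \<in> {0..M}" "AE z in lebesgue_on (QT T). v z \<in> {0..M}"
      using bounds by (auto elim: eventually_mono)
    then have "u z \<in> {0..M}" "v z \<in> {0..M}" if "z \<in> QT T" for z
      using continuous_on_AE_closed[OF QT(1) continuous_on_subset[OF cont(1) QT(2)] closed_atLeastAtMost _ that]
        continuous_on_AE_closed[OF QT(1) continuous_on_subset[OF cont(2) QT(2)] closed_atLeastAtMost _ that]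
      by blast+
    then have uv: "\<And>z. z \<in> QT T \<Longrightarrow> 0 \<le> u z \<and> u z \<le> M" "\<And>z. z \<in> QT T \<Longrightarrow> 0 \<le> v z \<and> v z \<le> M"
      "\<And>z. z \<in> QT T \<Longrightarrow> 0 \<le> g z"
      using g_nonneg by auto
    have "?I \<le> ?U"
      using classical_estimate[OF T du _ C21(1) eq(1) cont(1) init(1) uv(1,3) g_meas] M by (simp add: g_def)
    moreover have "?I \<le> ?V"
      using classical_estimate[OF T _ _ C21(2) eq(2) cont(2) init(2) uv(2,3) g_meas] classical(1) M by (simp add: g_def)
    ultimately show ?thesis ..
  next
    case weak
    have u_ae: "AE z in lebesgue_on (QT T). 0 \<le> u z \<and> u z \<le> M"
      and v_ae: "AE z in lebesgue_on (QT T). 0 \<le> v z \<and> v z \<le> M"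
      using bounds by (auto elim: eventually_mono)
    \<comment> \<open>This bound grows with \<open>k\<close>, but it only secures integrability and
      does not reach the conclusion.\<close>
    have g_ae: "AE z in lebesgue_on (QT T). 0 \<le> g z \<and> g z \<le> k * F M M"
      using bounds by eventually_elim (use g_nonneg g_le in auto)
    \<comment> \<open>The equation for \<open>v\<close> receives a diffusion term with coefficient
      0, so that one estimate serves both components.\<close>
    have id: "(LINT z:QT T|lebesgue. u z * \<psi>t z) + (LINT z:QT T|lebesgue. du * u z * \<psi>xx z - g z * \<psi> z)
          = - (LINT x|lebesgue. a x * \<psi> (x, 0))"
      "(LINT z:QT T|lebesgue. v z * \<psi>t z) + (LINT z:QT T|lebesgue. 0 * v z * \<psi>xx z - g z * \<psi> z)
          = - (LINT x|lebesgue. b x * \<psi> (x, 0))"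
      if "C21_strip 0 T \<psi> \<psi>x \<psi>xx \<psi>t" "\<forall>x. \<psi> (x, T) = 0"
        "\<exists>J>0. \<forall>x. \<forall>t\<in>{0..T}. \<psi> (x, t) \<noteq> 0 \<longrightarrow> x \<in> {-J..J}" for \<psi> \<psi>x \<psi>xx \<psi>t
    proof -
      have *: "(LINT z:QT T|lebesgue. u z * \<psi>t z) +
        (LINT z:QT T|lebesgue. du * u z * \<psi>xx z - k * F (u z) (v z) * \<psi> z)
          = - (LINT x|lebesgue. a x * \<psi> (x, 0)) \<and>
        (LINT z:QT T|lebesgue. v z * \<psi>t z) - (LINT z:QT T|lebesgue. k * F (u z) (v z) * \<psi> z)
          = - (LINT x|lebesgue. b x * \<psi> (x, 0))"
        using weak(2) that unfolding weak_solution_def by blast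
      then show "(LINT z:QT T|lebesgue. u z * \<psi>t z) + (LINT z:QT T|lebesgue. du * u z * \<psi>xx z - g z * \<psi> z)
          = - (LINT x|lebesgue. a x * \<psi> (x, 0))"
        by (simp add: g_def)
      show "(LINT z:QT T|lebesgue. v z * \<psi>t z) + (LINT z:QT T|lebesgue. 0 * v z * \<psi>xx z - g z * \<psi> z)
          = - (LINT x|lebesgue. b x * \<psi> (x, 0))"
        using * by (simp add: g_def set_lebesgue_integral_def)
    qed
    have "?I \<le> ?U"
      using weak_estimate[OF T du _ meas(1) g_meas u_ae g_ae id(1)] M by (simp add: g_def)
    moreover have "?I \<le> ?V"
      using weak_estimate[OF T _ _ meas(2) g_meas v_ae g_ae id(2)] M weak(1) by (simp add: g_def)
    ultimately show ?thesis ..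
  qed
  then show "?I \<le> ?U" "?I \<le> ?V" by auto
qed

theorem lemma2p12:
  fixes T U0 V0 M du D :: real
    and F u0 v0 :: "real \<Rightarrow> real \<Rightarrow> real"
  assumes "T > 0" and "U0 > 0" and "V0 > 0" and "M \<ge> max U0 V0"
    and "admissible_F F"
    and "admissible_initial_data U0 V0 M u0 v0"
    and "du > 0" and "D > 0"
  shows "\<exists>C::real. C > 0 \<and>
    (\<forall>dv\<in>{0..D}. \<forall>k>0. \<forall>u v :: real \<times> real \<Rightarrow> real.
       solution T du dv k F (u0 k) (v0 k) u v \<longrightarrow>
       (AE z in lebesgue_on (QT T). 0 \<le> u z \<and> u z \<le> M \<and> 0 \<le> v z \<and> v z \<le> M) \<longrightarrow>
       (\<integral>\<^sup>+t\<in>{0<..<T}. (\<integral>\<^sup>+x. ennreal (k * F (u (x, t)) (v (x, t))) \<partial>lebesgue) \<partial>lebesgue)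
         \<le> ennreal C)"
proof -
  have M: "0 < M" using assms by auto
  have fam: "L1_continuous_family u0 (u0_inf U0)" "L1_continuous_family v0 (v0_inf V0)"
    using assms(6) by (auto simp: admissible_initial_data_def)
  obtain Ku Kv where K: "\<And>k. k \<ge> 0 \<Longrightarrow> L1_norm (\<lambda>x. u0 k x - u0_inf U0 x) \<le> Ku"
    "\<And>k. k \<ge> 0 \<Longrightarrow> L1_norm (\<lambda>x. v0 k x - v0_inf V0 x) \<le> Kv"
    using L1_continuous_family_bounded[OF fam(1)] L1_continuous_family_bounded[OF fam(2)] by blast
  \<comment> \<open>\<open>Ku\<close> and \<open>Kv\<close> bound the \<open>L^1\<close> distances
    to the step data, \<open>U0\<close> and \<open>V0\<close> their mass under a unit ramp.
    Replacing \<open>dv\<close> by \<open>D\<close> in \<open>Cv\<close> gives uniformity in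
    \<open>dv\<close>.\<close>
  define Cu where "Cu = du * M * T * 120 + (Ku + U0)"
  define Cv where "Cv = D * M * T * 120 + (Kv + V0)"
  show ?thesis
  \<comment> \<open>The summand 1 yields strict positivity; the maxima make the constant an upper
    bound whatever the signs of \<open>Cu\<close> and \<open>Cv\<close>.\<close>
  proof (intro exI[of _ "max 0 Cu + max 0 Cv + 1"] conjI ballI allI impI)
    fix dv k u v
    assume dv: "dv \<in> {0..D}" and k: "0 < k" and sol: "solution T du dv k F (u0 k) (v0 k) u v"
      and bounds: "AE z in lebesgue_on (QT T). 0 \<le> u z \<and> u z \<le> M \<and> 0 \<le> v z \<and> v z \<le> M"
    define R where "R = lebesgue_on (QT T)"
    define g where "g z = k * F (u z) (v z)" for z
    \<comment> \<open>\<open>left n\<close> is 1 on \<open>[-n, 0]\<close> and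
      \<open>right n\<close> is 1 on \<open>[0, n]\<close>; their inner ramps lie on
      \<open>[0, 1]\<close> and \<open>[-1, 0]\<close>, so no gap remains around 0.\<close>
    define left where "left n = plateau (- real n - 1) 0" for n
    define right where "right n = plateau (- 1) (real n)" for n
    have g_meas: "g \<in> borel_measurable R"
      unfolding g_def[abs_def] R_def by (intro borel_measurable_times borel_measurable_const
          admissible_F_measurable[OF assms(5) M solution_measurable[OF sol] QT_sets(2) bounds])
    have est_right: "(\<integral>\<^sup>+z. ennreal (g z * right n (fst z)) \<partial>R) \<le> ennreal Cu" for n
    proof -
      interpret cutoff "real n + 2" 120 "right n" "plateau' (- 1) (real n)" "plateau'' (- 1) (real n)"
        unfolding right_def by (rule cutoff_plateau) auto
      have "(LINT x|lebesgue. u0 k x * right n x) \<le> L1_norm (\<lambda>x. u0 k x - u0_inf U0 x) + U0"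
      proof (rule initial_estimate)
        \<comment> \<open>The step lives on \<open>x < 0\<close> and \<open>right n\<close> on
          \<open>x > -1\<close>, so only the inner ramp sees it.\<close>
        show "u0_inf U0 x * right n x \<le> U0 * indicator {- 1..- 1 + 1} x" for x
          using assms(2) le_1[of x] by (auto simp: u0_inf_def right_def plateau_eq_0 indicator_def)
      qed (use fam(1) k assms(2) in \<open>auto simp: L1_continuous_family_def\<close>)
      then have "du * M * T * 120 + (LINT x|lebesgue. u0 k x * right n x) \<le> Cu"
        using K(1)[of k] k by (simp add: Cu_def)
      then show ?thesis
        using solution_estimate(1)[OF assms(1) M _ k assms(5) sol bounds] assms(7)
        by (auto simp: R_def g_def intro: order_trans ennreal_leI)
    qed
    have est_left: "(\<integral>\<^sup>+z. ennreal (g z * left n (fst z)) \<partial>R) \<le> ennreal Cv" for n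
    proof -
      interpret cutoff "real n + 2" 120 "left n" "plateau' (- real n - 1) 0" "plateau'' (- real n - 1) 0"
        unfolding left_def by (rule cutoff_plateau) auto
      have "(LINT x|lebesgue. v0 k x * left n x) \<le> L1_norm (\<lambda>x. v0 k x - v0_inf V0 x) + V0"
      proof (rule initial_estimate)
        show "v0_inf V0 x * left n x \<le> V0 * indicator {0..0 + 1} x" for x
          using assms(3) le_1[of x] by (auto simp: v0_inf_def left_def plateau_eq_0 indicator_def)
      qed (use fam(2) k assms(3) in \<open>auto simp: L1_continuous_family_def\<close>)
      moreover have "dv * M * T * 120 \<le> D * M * T * 120"
        using dv M assms(1) by (intro mult_right_mono) auto
      ultimately have "dv * M * T * 120 + (LINT x|lebesgue. v0 k x * left n x) \<le> Cv"
        using K(2)[of k] k by (simp add: Cv_def)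
      then show ?thesis
        using solution_estimate(2)[OF assms(1) M _ k assms(5) sol bounds] assms(7)
        by (auto simp: R_def g_def intro: order_trans ennreal_leI)
    qed
    have lr_meas: "(\<lambda>z. ennreal (g z * p (fst z))) \<in> borel_measurable R" if "continuous_on UNIV p" for p :: "real \<Rightarrow> real"
    proof -
      have "(\<lambda>z::real \<times> real. p (fst z)) \<in> borel_measurable borel"
        by (intro borel_measurable_continuous_onI continuous_on_compose2[OF that] continuous_intros) auto
      from borel_measurable_lebesgue_onI[OF this, of "QT T"] show ?thesis using g_meas by (simp add: R_def)
    qed
    have plateau_cont: "continuous_on UNIV (plateau a b)" for a b
      using plateau_deriv by (meson DERIV_isCont continuous_at_imp_continuous_on)
    have "(\<integral>\<^sup>+z. ennreal (g z) \<partial>R) \<le> ennreal Cu + ennreal Cv"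
    proof (rule nn_integral_le_limit[OF _ _ _ tendsto_const])
      fix n
      show "(\<lambda>z. ennreal (g z * right n (fst z)) + ennreal (g z * left n (fst z))) \<in> borel_measurable R"
        unfolding left_def right_def by (intro borel_measurable_add lr_meas plateau_cont)
      show "(\<integral>\<^sup>+z. ennreal (g z * right n (fst z)) + ennreal (g z * left n (fst z)) \<partial>R) \<le> ennreal Cu + ennreal Cv"
        unfolding left_def right_def
        by (subst nn_integral_add) (intro lr_meas plateau_cont add_mono est_left[unfolded left_def] est_right[unfolded right_def])+
    next
      fix z :: "real \<times> real"
      have "\<forall>\<^sub>F n in sequentially. \<bar>fst z\<bar> \<le> real n"
        using eventually_ge_at_top[of "nat \<lceil>\<bar>fst z\<bar>\<rceil>"] by eventually_elim linarith
      then have "\<forall>\<^sub>F n in sequentially. ennreal (g z) \<le> ennreal (g z * right n (fst z)) + ennreal (g z * left n (fst z))"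
      proof eventually_elim
        case (elim n)
        then show ?case
          by (cases "fst z \<le> 0") (auto simp: left_def right_def plateau_eq_1)
      qed
      then show "ennreal (g z) \<le> liminf (\<lambda>n. ennreal (g z * right n (fst z)) + ennreal (g z * left n (fst z)))"
        by (rule Liminf_bounded)
    qed
    also have "\<dots> \<le> ennreal (max 0 Cu + max 0 Cv + 1)"
      by (auto simp: max_def ennreal_neg simp flip: ennreal_plus intro!: ennreal_leI)
    finally have le: "(\<integral>\<^sup>+z. ennreal (g z) \<partial>R) \<le> ennreal (max 0 Cu + max 0 Cv + 1)" .
    have "(\<lambda>z. ennreal (g z)) \<in> borel_measurable (lebesgue_on (QT T))"
      using g_meas by (simp add: R_def)
    \<comment> \<open>\<open>g\<close> is known to be measurable only on the strip, so it is
      extended by zero before the integral over the plane is iterated.\<close>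
    then have "(\<lambda>z. ennreal (g z) * indicator (QT T) z) \<in> borel_measurable lebesgue"
      using QT_sets(2) by (subst (asm) borel_measurable_restrict_space_iff_ennreal) auto
    from nn_integral_lebesgue_iterated[OF this]
    have "(\<integral>\<^sup>+t. (\<integral>\<^sup>+x. ennreal (g (x, t)) * indicator (QT T) (x, t) \<partial>lebesgue) \<partial>lebesgue) = (\<integral>\<^sup>+z. ennreal (g z) \<partial>R)"
      using QT_sets(2) by (simp add: R_def nn_integral_restrict_space)
    moreover have "(\<integral>\<^sup>+t\<in>{0<..<T}. (\<integral>\<^sup>+x. ennreal (g (x, t)) \<partial>lebesgue) \<partial>lebesgue)
        = (\<integral>\<^sup>+t. (\<integral>\<^sup>+x. ennreal (g (x, t)) * indicator (QT T) (x, t) \<partial>lebesgue) \<partial>lebesgue)"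
      by (intro nn_integral_cong) (auto simp: QT_def indicator_def)
    ultimately show "(\<integral>\<^sup>+t\<in>{0<..<T}. (\<integral>\<^sup>+x. ennreal (k * F (u (x, t)) (v (x, t))) \<partial>lebesgue) \<partial>lebesgue)
         \<le> ennreal (max 0 Cu + max 0 Cv + 1)"
      using le by (simp add: g_def)
  qed auto
qed

end
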